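(* Let $\Gamma$ be a word-hyperbolic group. Let $\mathcal{A}\Gamma$ be an unconditional admissible Fréchet algebra over $\mathbb{C}\Gamma$ and let $\mathcal{A}_\omega\Gamma=\bigcup_n\mathcal{A}_n\Gamma$ be its canonical bornological subalgebra. Let $S$ be a finite symmetric set of generators of $\Gamma$ and choose an element $h(\langle x\rangle)$ of minimal word length (with respect to $S$) in every conjugacy class $\langle x\rangle$ of $\Gamma$. Then the characteristic linear map $$\mathbb{C}\Gamma\to\mathbb{C}\Gamma,\qquad u_g\mapsto u_{h(\langle g\rangle)}$$ extends to a bounded linear operator $\mathbf{\Phi}:\mathcal{A}_\omega\Gamma\to\mathcal{A}_\omega\Gamma$. More precisely, for $n<m$ the characteristic linear map extends to a bounded linear operator $\mathbf{\Phi}:\mathcal{A}_n\Gamma\to\mathcal{A}_m\Gamma$.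
   Context: For a set $X$, $\mathbb{C}X$ is the complex vector space with basis $(u_x)_{x\in X}$; for $a=\sum a_xu_x$ put $|a|=\sum|a_x|u_x$, and write $|a|\le|b|$ if $|a_x|\le|b_x|$ for all $x$. A seminorm on $\mathbb{C}X$ is unconditional if $|a|\le|b|$ implies $\|a\|\le\|b\|$. $\mathbb{C}\Gamma$ is the group ring. An unconditional Banach (Fréchet) algebra over $\mathbb{C}\Gamma$ is a Banach (Fréchet) algebra obtained from $\mathbb{C}\Gamma$ by completion with respect to a (countable) family of unconditional seminorms; it contains $\mathbb{C}\Gamma$ as a dense subalgebra. A Fréchet algebra $A$ is admissible if there is an open neighbourhood $U$ of $0$ (called an open unit ball) such that for every compact $K\subset U$ the union $\bigcup_{n\ge1}K^n$ is relatively compact in $A$. The algebras $\mathcal{A}_n\Gamma$: fix a finite symmetric generating set $S$ with word length $l_S$ and an open unit ball $U\subset\mathcal{A}\Gamma$ stable under $a\mapsto|a|$. For $n\ge1$ put $$T_n=\Big(\sum_{l_S(g)\le n}\mathbb{C}u_g\Big)\cap\tfrac{n}{n+1}U .$$ Let $\|\cdot\|_n$ be the largest unconditional submultiplicative seminorm on $\mathbb{C}\Gamma$ with $\|T_n\|_n\le1$ (i.e. $\|t\|_n\le 1$ for all $t\in T_n$). $\mathcal{A}_n\Gamma$ is the completion of $\mathbb{C}\Gamma$ with respect to $\|\cdot\|_n$. For $n<m$ the identity of $\mathbb{C}\Gamma$ extends to a bounded homomorphism $\mathcal{A}_n\Gamma\to\mathcal{A}_m\Gamma$. $\mathcal{A}_\omega\Gamma=\bigcup_n\mathcal{A}_n\Gamma$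 is a bornological algebra (a set is bounded if it is contained and bounded in some $\mathcal{A}_n\Gamma$); it is independent of the choices of $S$ and $U$. In the statement the $\mathcal{A}_n\Gamma$ are formed with the given $S$ and some such $U$. $\langle x\rangle$ denotes the conjugacy class of $x\in\Gamma$. *)

theory Defs
  imports
    "HOL-Analysis.Analysis"
    "HOL-Library.Poly_Mapping"
    "HOL-Library.Set_Algebras"
    "HOL-Library.Function_Algebras"
begin

section \<open>Word-hyperbolic groups\<close>

text \<open>
  Groups are types of class \<^class>\<open>group_add\<close>, which is not assumed to be commutative: the group
  law is written \<open>x + y\<close>, the inverse \<open>- x\<close> and the identity \<open>0\<close>. With this choice the convolution
  ring on finitely supported functions from \<^theory>\<open>HOL-Library.Poly_Mapping\<close> is the group ring.
\<close>

definition symmetric_generating_set :: "'g::group_add set \<Rightarrow> bool" where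
  "symmetric_generating_set S \<longleftrightarrow>
     finite S \<and> uminus ` S = S \<and> (\<forall>g. \<exists>w\<in>lists S. sum_list w = g)"

definition word_length :: "'g::group_add set \<Rightarrow> 'g \<Rightarrow> nat" where
  "word_length S g = (LEAST n. \<exists>w\<in>lists S. length w = n \<and> sum_list w = g)"

definition word_dist :: "'g::group_add set \<Rightarrow> 'g \<Rightarrow> 'g \<Rightarrow> real" where
  "word_dist S x y = real (word_length S (- x + y))"

definition gromov_product :: "'g::group_add set \<Rightarrow> 'g \<Rightarrow> 'g \<Rightarrow> 'g \<Rightarrow> real" where
  "gromov_product S w x y = (word_dist S w x + word_dist S w y - word_dist S x y) / 2"

text \<open>Hyperbolicity in the sense of Gromov (four-point condition) for some word metric.\<close>

definition word_hyperbolic :: "'g::group_add itself \<Rightarrow> bool" where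
  "word_hyperbolic _ \<longleftrightarrow>
     (\<exists>(S::'g set) \<delta>. symmetric_generating_set S \<and>
        (\<forall>w x y z. gromov_product S w x z
                     \<ge> min (gromov_product S w x y) (gromov_product S w y z) - \<delta>))"

definition conj_class :: "'g::group_add \<Rightarrow> 'g set" where
  "conj_class x = {y + x - y | y. True}"


section \<open>The group ring and unconditional seminorms\<close>

type_synonym 'g group_ring = "'g \<Rightarrow>\<^sub>0 complex"

definition gr_scale :: "complex \<Rightarrow> 'g group_ring \<Rightarrow> 'g group_ring" where
  "gr_scale c a = Poly_Mapping.map (\<lambda>z. c * z) a"

definition gr_abs :: "'g group_ring \<Rightarrow> 'g group_ring" where
  "gr_abs a = Poly_Mapping.map (\<lambda>z. complex_of_real (cmod z)) a"

definition is_seminorm :: "(complex \<Rightarrow> 'v \<Rightarrow> 'v) \<Rightarrow> ('v::ab_group_add \<Rightarrow> real) \<Rightarrow> bool" where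
  "is_seminorm sc p \<longleftrightarrow>
     (\<forall>x y. p (x + y) \<le> p x + p y) \<and> (\<forall>c x. p (sc c x) = cmod c * p x)"

definition unconditional_seminorm :: "('g group_ring \<Rightarrow> real) \<Rightarrow> bool" where
  "unconditional_seminorm p \<longleftrightarrow> is_seminorm gr_scale p \<and>
     (\<forall>a b. (\<forall>x. cmod (Poly_Mapping.lookup a x) \<le> cmod (Poly_Mapping.lookup b x)) \<longrightarrow> p a \<le> p b)"

definition cauchy_seqs :: "('v::ab_group_add \<Rightarrow> real) \<Rightarrow> (nat \<Rightarrow> 'v) set" where
  "cauchy_seqs p = {X. \<forall>e>0. \<exists>M. \<forall>i\<ge>M. \<forall>j\<ge>M. p (X i - X j) < e}"

definition null_seqs :: "('v::ab_group_add \<Rightarrow> real) \<Rightarrow> (nat \<Rightarrow> 'v) set" where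
  "null_seqs p = {X. (\<lambda>i. p (X i)) \<longlonglongrightarrow> 0}"


section \<open>Unconditional admissible Fr\'echet algebras\<close>

text \<open>
  A Fr\'echet algebra is a complex algebra whose (Hausdorff) topology is given by a countable family
  of seminorms, which is complete, and whose multiplication is jointly continuous. The Hausdorff
  property is the class constraint \<^class>\<open>t2_space\<close>.
\<close>

definition frechet_algebra ::
  "(complex \<Rightarrow> 'a \<Rightarrow> 'a) \<Rightarrow> (nat \<Rightarrow> 'a::{ring_1,t2_space} \<Rightarrow> real) \<Rightarrow> bool" where
  "frechet_algebra sc Q \<longleftrightarrow>
     vector_space sc \<and>
     (\<forall>c x y. sc c (x * y) = sc c x * y \<and> sc c (x * y) = x * sc c y) \<and>
     (\<forall>i. is_seminorm sc (Q i)) \<and>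
     (\<forall>V. open V \<longleftrightarrow> (\<forall>x\<in>V. \<exists>k. \<exists>e>0. {y. \<forall>i\<le>k. Q i (y - x) < e} \<subseteq> V)) \<and>
     (\<forall>X. (\<forall>i. X \<in> cauchy_seqs (Q i)) \<longrightarrow> convergent X) \<and>
     continuous_on UNIV (\<lambda>(x::'a, y). x * y)"

text \<open>
  The completion of the group ring for a countable family of unconditional seminorms is described by
  the inclusion \<open>\<iota>\<close> of the group ring: the algebra is complete, the image of \<open>\<iota>\<close> is dense, and the
  defining seminorms restrict to unconditional seminorms on the group ring.
\<close>

definition unconditional_frechet_algebra ::
  "(complex \<Rightarrow> 'a \<Rightarrow> 'a) \<Rightarrow> ('g::group_add group_ring \<Rightarrow> 'a::{ring_1,t2_space}) \<Rightarrow> bool" where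
  "unconditional_frechet_algebra sc \<iota> \<longleftrightarrow>
     (\<forall>a b. \<iota> (a + b) = \<iota> a + \<iota> b) \<and>
     (\<forall>c a. \<iota> (gr_scale c a) = sc c (\<iota> a)) \<and>
     (\<forall>a b. \<iota> (a * b) = \<iota> a * \<iota> b) \<and>
     \<iota> 1 = 1 \<and> inj \<iota> \<and> closure (\<iota> ` UNIV) = UNIV \<and>
     (\<exists>Q. frechet_algebra sc Q \<and> (\<forall>i. unconditional_seminorm (\<lambda>a. Q i (\<iota> a))))"

text \<open>\<open>K ^ n\<close> is the set of \<open>n\<close>-fold products, by \<^theory>\<open>HOL-Library.Set_Algebras\<close>.\<close>

definition open_unit_ball :: "'a::{ring_1,topological_space} set \<Rightarrow> bool" where
  "open_unit_ball U \<longleftrightarrow> open U \<and> 0 \<in> U \<and>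
     (\<forall>K. compact K \<and> K \<subseteq> U \<longrightarrow> compact (closure (\<Union>n\<in>{1..}. K ^ n)))"

definition admissible :: "'a::{ring_1,topological_space} itself \<Rightarrow> bool" where
  "admissible _ \<longleftrightarrow> (\<exists>U::'a set. open_unit_ball U)"

text \<open>
  On the algebra, \<open>a \<mapsto> |a|\<close> is the unique continuous extension of the absolute value of the group
  ring; it exists because \<open>||a| - |b|| \<le> |a - b|\<close>.
\<close>

definition alg_abs :: "('g group_ring \<Rightarrow> 'a::t2_space) \<Rightarrow> 'a \<Rightarrow> 'a" where
  "alg_abs \<iota> = (THE f. continuous_on UNIV f \<and> (\<forall>a. f (\<iota> a) = \<iota> (gr_abs a)))"


section \<open>The seminorms defining the canonical bornological subalgebra\<close>

definition T_set ::
  "(complex \<Rightarrow> 'a \<Rightarrow> 'a) \<Rightarrow> ('g::group_add group_ring \<Rightarrow> 'a) \<Rightarrow> 'g set \<Rightarrow> 'a set \<Rightarrow> nat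
     \<Rightarrow> 'g group_ring set" where
  "T_set sc \<iota> S U n =
     {a. (\<forall>g\<in>Poly_Mapping.keys a. word_length S g \<le> n) \<and>
         \<iota> a \<in> sc (of_nat n / of_nat (n + 1)) ` U}"

text \<open>The order on seminorms is the pointwise one. The largest one exists as a pointwise supremum: small
  multiples of the generators lie in the set \<open>T_set sc \<iota> S U n\<close>, so the supremum is finite.\<close>

definition A_seminorm ::
  "(complex \<Rightarrow> 'a \<Rightarrow> 'a) \<Rightarrow> ('g::group_add group_ring \<Rightarrow> 'a) \<Rightarrow> 'g set \<Rightarrow> 'a set \<Rightarrow> nat
     \<Rightarrow> 'g group_ring \<Rightarrow> real" where
  "A_seminorm sc \<iota> S U n =
     (GREATEST p. unconditional_seminorm p \<and> (\<forall>a b. p (a * b) \<le> p a * p b) \<and>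
                  (\<forall>t\<in>T_set sc \<iota> S U n. p t \<le> 1))"


section \<open>Completions and their union\<close>

text \<open>
  The completion for a seminorm \<open>p\<close> is the quotient of the space of \<open>p\<close>-Cauchy sequences by the
  subspace of \<open>p\<close>-null sequences. Its elements are cosets \<open>X +o N\<close>. The sum of two cosets is the sum
  of sets \<open>\<xi> + \<eta>\<close>; the set of multiples of the elements of a coset must be enlarged by \<open>N\<close> to be a
  coset also when the scalar is \<open>0\<close>.
\<close>

definition coset_scale ::
  "(nat \<Rightarrow> 'g group_ring) set \<Rightarrow> complex \<Rightarrow> (nat \<Rightarrow> 'g group_ring) set
     \<Rightarrow> (nat \<Rightarrow> 'g group_ring) set" where
  "coset_scale N c \<xi> = (\<lambda>X i. gr_scale c (X i)) ` \<xi> + N"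

definition cauchy_completion :: "('g group_ring \<Rightarrow> real) \<Rightarrow> (nat \<Rightarrow> 'g group_ring) set set" where
  "cauchy_completion p = (\<lambda>X. X +o null_seqs p) ` cauchy_seqs p"

definition completion_embed ::
  "('g group_ring \<Rightarrow> real) \<Rightarrow> 'g group_ring \<Rightarrow> (nat \<Rightarrow> 'g group_ring) set" where
  "completion_embed p a = (\<lambda>_. a) +o null_seqs p"

definition completion_norm ::
  "('g group_ring \<Rightarrow> real) \<Rightarrow> (nat \<Rightarrow> 'g group_ring) set \<Rightarrow> real" where
  "completion_norm p \<xi> = (THE r. \<forall>X\<in>\<xi>. (\<lambda>i. p (X i)) \<longlonglongrightarrow> r)"

text \<open>
  For seminorms \<open>p 1 \<ge> p 2 \<ge> \<dots>\<close> the union of the completions is formed along the maps induced by the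
  identity of the group ring. This inductive limit of the quotients \<open>cauchy_seqs (p n) / null_seqs
  (p n)\<close> is the quotient of the union of the numerators by the union of the denominators; the
  \<open>n\<close>-th completion is mapped to it by \<open>X +o null_seqs (p n) \<mapsto> X +o union_null p\<close>.
\<close>

definition union_null :: "(nat \<Rightarrow> 'g group_ring \<Rightarrow> real) \<Rightarrow> (nat \<Rightarrow> 'g group_ring) set" where
  "union_null p = (\<Union>n\<in>{1..}. null_seqs (p n))"

definition union_space :: "(nat \<Rightarrow> 'g group_ring \<Rightarrow> real) \<Rightarrow> (nat \<Rightarrow> 'g group_ring) set set" where
  "union_space p = (\<lambda>X. X +o union_null p) ` (\<Union>n\<in>{1..}. cauchy_seqs (p n))"

definition union_embed ::
  "(nat \<Rightarrow> 'g group_ring \<Rightarrow> real) \<Rightarrow> 'g group_ring \<Rightarrow> (nat \<Rightarrow> 'g group_ring) set" where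
  "union_embed p a = (\<lambda>_. a) +o union_null p"

definition to_union ::
  "(nat \<Rightarrow> 'g group_ring \<Rightarrow> real) \<Rightarrow> (nat \<Rightarrow> 'g group_ring) set \<Rightarrow> (nat \<Rightarrow> 'g group_ring) set" where
  "to_union p \<xi> = \<xi> + union_null p"

definition union_bounded ::
  "(nat \<Rightarrow> 'g group_ring \<Rightarrow> real) \<Rightarrow> (nat \<Rightarrow> 'g group_ring) set set \<Rightarrow> bool" where
  "union_bounded p B \<longleftrightarrow>
     (\<exists>n\<ge>1. \<exists>B'\<subseteq>cauchy_completion (p n). (\<exists>r. \<forall>\<xi>\<in>B'. completion_norm (p n) \<xi> \<le> r) \<and> B = to_union p ` B')"

definition linear_map_on ::
  "'v set \<Rightarrow> (complex \<Rightarrow> 'v \<Rightarrow> 'v) \<Rightarrow> 'w set \<Rightarrow> (complex \<Rightarrow> 'w \<Rightarrow> 'w) \<Rightarrow> ('v::plus \<Rightarrow> 'w::plus) \<Rightarrow> bool"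
  where
  "linear_map_on V scV W scW f \<longleftrightarrow> f ` V \<subseteq> W \<and>
     (\<forall>x\<in>V. \<forall>y\<in>V. f (x + y) = f x + f y) \<and> (\<forall>c. \<forall>x\<in>V. f (scV c x) = scW c (f x))"

definition bounded_operator_completion ::
  "('g group_ring \<Rightarrow> real) \<Rightarrow> ('g group_ring \<Rightarrow> real)
     \<Rightarrow> ((nat \<Rightarrow> 'g group_ring) set \<Rightarrow> (nat \<Rightarrow> 'g group_ring) set) \<Rightarrow> bool" where
  "bounded_operator_completion p q \<Phi> \<longleftrightarrow>
     linear_map_on (cauchy_completion p) (coset_scale (null_seqs p))
                   (cauchy_completion q) (coset_scale (null_seqs q)) \<Phi> \<and>
     (\<exists>C. \<forall>\<xi>\<in>cauchy_completion p. completion_norm q (\<Phi> \<xi>) \<le> C * completion_norm p \<xi>)"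

definition bounded_operator_union ::
  "(nat \<Rightarrow> 'g group_ring \<Rightarrow> real)
     \<Rightarrow> ((nat \<Rightarrow> 'g group_ring) set \<Rightarrow> (nat \<Rightarrow> 'g group_ring) set) \<Rightarrow> bool" where
  "bounded_operator_union p \<Phi> \<longleftrightarrow>
     linear_map_on (union_space p) (coset_scale (union_null p))
                   (union_space p) (coset_scale (union_null p)) \<Phi> \<and>
     (\<forall>B. union_bounded p B \<longrightarrow> union_bounded p (\<Phi> ` B))"


section \<open>The characteristic linear map\<close>

definition char_map :: "('g::group_add set \<Rightarrow> 'g) \<Rightarrow> 'g group_ring \<Rightarrow> 'g group_ring" where
  "char_map h a =
     (\<Sum>g\<in>Poly_Mapping.keys a. Poly_Mapping.single (h (conj_class g)) (Poly_Mapping.lookup a g))"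

end

theory Submission
  imports Defs
begin

text \<open>
  In this overview the group is written multiplicatively. Write \<open>\<Phi>\<close> for the linear map
  \<open>u_g \<mapsto> u_{h(g)}\<close> and \<open>p n\<close> for the \<open>n\<close>-th seminorm. Everything follows
  from the estimate \<open>p m (\<Phi> a) \<le> C * p n a\<close> for \<open>1 \<le> n < m\<close> (\<open>char_map_bounded\<close>): a linear map with this
  property acts on Cauchy sequences and null sequences, hence on the completions and on their union.

  The seminorm \<open>p n\<close> is by definition the largest submultiplicative unconditional seminorm that is at
  most \<open>1\<close> on \<open>T_n\<close>. It is also the largest one among all unconditional seminorms, submultiplicative or
  not, that are at most \<open>1\<close> on every product \<open>|t_1| ... |t_k|\<close> with \<open>t_i \<in> T_n\<close>
  (\<open>largest_seminorm_submultiplicative\<close>). As \<open>a \<mapsto> p m (\<Phi> |a|)\<close> is an unconditional seminorm, the estimate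
  reduces to a bound for \<open>p m (\<Phi> (|t_1| ... |t_k|))\<close> that does not depend on \<open>k\<close> or on the \<open>t_i\<close>.

  Two effects compete here. Since \<open>T_n\<close> is contained in a proper multiple of \<open>T_m\<close>, there is \<open>\<rho> < 1\<close> with
  \<open>p m t \<le> \<rho>\<close> on \<open>T_n\<close>, so a product of \<open>k\<close> factors has seminorm at most \<open>\<rho>^k\<close> (\<open>T_set_shrink\<close>).
  On the other hand, let \<open>g = g_1 ... g_k\<close> with \<open>g_i\<close> of length at most \<open>n\<close>. Hyperbolicity implies that
  \<open>h(g)\<close> arises from some cyclic permutation \<open>g_{i+1} ... g_k g_1 ... g_i\<close> by conjugation with an element
  \<open>y\<close> whose length is only \<open>O(log k)\<close> (\<open>logarithmic_conjugator\<close>). Hence \<open>\<Phi> (|t_1| ... |t_k|)\<close> is a sum,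
  over \<open>i < k\<close> and over \<open>y\<close> in a ball of radius \<open>O(log k)\<close>, of elements dominated by
  \<open>u_{y^-1} |t_{i+1}| ... |t_k| |t_1| ... |t_i| u_y\<close>. The number of summands and the seminorms of \<open>u_y\<close> and
  \<open>u_{y^-1}\<close> grow at most exponentially in \<open>log k\<close>, that is, polynomially in \<open>k\<close>, and this loss is absorbed
  by \<open>\<rho>^k\<close> (\<open>char_map_product_bound\<close>).

  The geometric input is that in a \<open>\<delta>\<close>-hyperbolic space a path with \<open>N\<close> steps comes within \<open>O(\<delta> log N)\<close>
  of every point of a geodesic between its ends. The points \<open>1, g_1, g_1 g_2, \<dots>, g\<close> form such a path from
  \<open>1\<close> to \<open>g\<close>. If \<open>h(g) = a^-1 g a\<close>, then \<open>a\<close> is a point that \<open>g\<close> moves by a minimal amount. In a tree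
  such points form the axis or the fixed point set of \<open>g\<close>, which the path has to meet; in
  \<open>conjugator_bound\<close> the same picture is made to work up to logarithmic errors.
\<close>

section \<open>Word lengths and conjugacy classes\<close>

lemma word_of_minimal_length:
  assumes "symmetric_generating_set S"
  obtains w where "w \<in> lists S" "length w = word_length S g" "sum_list w = g"
proof -
  obtain w where "w \<in> lists S" "sum_list w = g"
    using assms unfolding symmetric_generating_set_def by blast
  then have "\<exists>n. \<exists>w\<in>lists S. length w = n \<and> sum_list w = g" by blast
  then have "\<exists>w\<in>lists S. length w = word_length S g \<and> sum_list w = g"
    unfolding word_length_def by (rule LeastI_ex)
  then show thesis using that by blast
qed

lemma word_length_sum_list_le:
  assumes "w \<in> lists S"
  shows "word_length S (sum_list w) \<le> length w"
  unfolding word_length_def by (rule Least_le) (use assms in blast)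

lemma word_length_0 [simp]: "word_length S 0 = 0"
  using word_length_sum_list_le[of "[]" S] by simp

lemma word_length_add_le:
  assumes "symmetric_generating_set S"
  shows "word_length S (x + y) \<le> word_length S x + word_length S y"
proof -
  obtain v w where v: "v \<in> lists S" "length v = word_length S x" "sum_list v = x"
    and w: "w \<in> lists S" "length w = word_length S y" "sum_list w = y"
    using word_of_minimal_length[OF assms] by metis
  show ?thesis using word_length_sum_list_le[of "v @ w" S] v w by simp
qed

lemma sum_list_rev_map_uminus: "sum_list (rev (map uminus w)) = - sum_list (w :: 'g::group_add list)"
  by (induction w) (simp_all add: minus_add)

lemma word_length_minus [simp]:
  assumes "symmetric_generating_set S"
  shows "word_length S (- x) = word_length S x"
proof -
  have "word_length S (- y) \<le> word_length S y" for y
  proof -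
    obtain v where v: "v \<in> lists S" "length v = word_length S y" "sum_list v = y"
      using word_of_minimal_length[OF assms] by metis
    have "uminus ` S = S" using assms unfolding symmetric_generating_set_def by blast
    then have "rev (map uminus v) \<in> lists S" using v(1) by (auto simp: in_lists_conv_set)
    then show ?thesis using word_length_sum_list_le[of "rev (map uminus v)" S] v
      by (simp add: sum_list_rev_map_uminus)
  qed
  from this[of x] this[of "-x"] show ?thesis by simp
qed

text \<open>
  Padding with the identity lets words of one fixed length represent all elements of the ball, which
  gives the exponential bound on its cardinality.
\<close>

lemma ball_subset_words:
  assumes "symmetric_generating_set S"
  shows "{g. word_length S g \<le> r} \<subseteq> sum_list ` {w. set w \<subseteq> insert 0 S \<and> length w = r}"
proof
  fix g assume "g \<in> {g. word_length S g \<le> r}"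
  moreover obtain v where v: "v \<in> lists S" "length v = word_length S g" "sum_list v = g"
    using word_of_minimal_length[OF assms] by metis
  moreover have "sum_list (replicate k 0) = (0::'a)" for k by (induction k) auto
  ultimately have "set (v @ replicate (r - length v) 0) \<subseteq> insert 0 S"
    "length (v @ replicate (r - length v) 0) = r" "sum_list (v @ replicate (r - length v) 0) = g"
    by (auto simp: in_lists_conv_set)
  then show "g \<in> sum_list ` {w. set w \<subseteq> insert 0 S \<and> length w = r}" by blast
qed

lemma ball_growth:
  assumes "symmetric_generating_set S"
  shows "finite {g. word_length S g \<le> r}" "card {g. word_length S g \<le> r} \<le> (card S + 1) ^ r"
proof -
  let ?L = "{w. set w \<subseteq> insert 0 S \<and> length w = r}"
  have S: "finite S" using assms unfolding symmetric_generating_set_def by blast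
  then have L: "finite ?L" "card ?L = card (insert 0 S) ^ r"
    by (simp_all add: finite_lists_length_eq card_lists_length_eq)
  show "finite {g. word_length S g \<le> r}"
    using ball_subset_words[OF assms] L(1) by (rule finite_subset[OF _ finite_imageI])
  have "card {g. word_length S g \<le> r} \<le> card (sum_list ` ?L)"
    using ball_subset_words[OF assms] L(1) by (intro card_mono) auto
  also have "\<dots> \<le> card (insert 0 S) ^ r" using card_image_le[OF L(1), of sum_list] L(2) by simp
  also have "\<dots> \<le> (card S + 1) ^ r" using S by (intro power_mono) (auto simp: card_insert_if)
  finally show "card {g. word_length S g \<le> r} \<le> (card S + 1) ^ r" .
qed

lemma word_length_sum_list_bound:
  assumes "symmetric_generating_set S" "\<And>s. s \<in> set w \<Longrightarrow> word_length S s \<le> A"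
  shows "word_length S (sum_list w) \<le> A * length w"
  using assms(2)
proof (induction w)
  case (Cons s w)
  have "word_length S (s + sum_list w) \<le> word_length S s + word_length S (sum_list w)"
    by (rule word_length_add_le[OF assms(1)])
  also have "\<dots> \<le> A + A * length w" using Cons by (intro add_mono) auto
  finally show ?case by simp
qed simp

lemma word_lengths_comparable:
  assumes "symmetric_generating_set S" "symmetric_generating_set S'"
  obtains A where "\<And>g. word_length S g \<le> A * word_length S' g"
proof -
  have fin: "finite (word_length S ` S')"
    using assms(2) unfolding symmetric_generating_set_def by blast
  define A where "A = Max (insert 0 (word_length S ` S'))"
  have A: "word_length S s \<le> A" if "s \<in> S'" for s
    unfolding A_def using that fin by (intro Max_ge) auto
  have "word_length S g \<le> A * word_length S' g" for g
  proof -
    obtain w where w: "w \<in> lists S'" "length w = word_length S' g" "sum_list w = g"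
      using word_of_minimal_length[OF assms(2)] by metis
    show ?thesis using word_length_sum_list_bound[OF assms(1), of w A] A w
      by (auto simp: in_lists_conv_set)
  qed
  then show thesis by (rule that)
qed

lemma conj_class_conjugate: "conj_class (- y + x + y) = conj_class (x::'g::group_add)"
proof -
  have "\<exists>v. u + (- y + x + y) - u = v + x - v" for u
    by (intro exI[of _ "u + - y"]) (simp only: diff_conv_add_uminus minus_add add.assoc minus_minus)
  moreover have "\<exists>v. u + x - u = v + (- y + x + y) - v" for u
    by (intro exI[of _ "u + y"]) (simp only: diff_conv_add_uminus minus_add add.assoc add_minus_cancel)
  ultimately show ?thesis unfolding conj_class_def by auto
qed

lemma conjugate_in_conj_class: "- y + x + y \<in> conj_class (x::'g::group_add)"
  unfolding conj_class_def by (auto intro!: exI[of _ "-y"])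

lemma sum_list_rotate_conjugate:
  assumes "j \<le> length gs"
  shows "sum_list (rotate j gs) = - sum_list (take j gs) + sum_list gs + sum_list (take j (gs :: 'g::group_add list))"
proof (cases "j = length gs")
  case False
  have "sum_list gs = sum_list (take j gs) + sum_list (drop j gs)"
    by (metis append_take_drop_id sum_list_append)
  then show ?thesis using assms False by (simp add: rotate_drop_take add.assoc[symmetric])
qed simp

section \<open>Conjugators of logarithmic length in hyperbolic groups\<close>

locale hyperbolic_word_metric =
  fixes S :: "'g::group_add set" and \<delta> :: real
  assumes gen: "symmetric_generating_set S"
    and hyp: "\<And>w x y z. gromov_product S w x z
                \<ge> min (gromov_product S w x y) (gromov_product S w y z) - \<delta>"
begin

abbreviation d :: "'g \<Rightarrow> 'g \<Rightarrow> real" where "d \<equiv> word_dist S"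

lemma d_nonneg: "d x y \<ge> 0" by (simp add: word_dist_def)
lemma d_same [simp]: "d x x = 0" by (simp add: word_dist_def)

lemma d_commute: "d x y = d y x"
  using word_length_minus[OF gen, of "- x + y"] by (simp add: word_dist_def minus_add)

lemma d_triangle: "d x z \<le> d x y + d y z"
proof -
  have "- x + z = (- x + y) + (- y + z)" by (simp add: add.assoc)
  then show ?thesis using word_length_add_le[OF gen, of "- x + y" "- y + z"]
    unfolding word_dist_def by (metis of_nat_add of_nat_le_iff)
qed

lemma d_left_invariant [simp]: "d (g + x) (g + y) = d x y"
  by (simp only: word_dist_def minus_add add.assoc minus_add_cancel)

lemma \<delta>_nonneg: "\<delta> \<ge> 0"
  using hyp[of 0 0 0 0] by (simp add: gromov_product_def)

text \<open>
  The inequality for Gromov products in symmetric form: of the three sums of opposite distances between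
  four points, the two largest differ by at most \<open>2 * \<delta>\<close>.
\<close>

lemma four_point:
  "d w y + d x z \<le> max (d w x + d y z) (d w z + d x y) + 2 * \<delta>"
  using hyp[of w x y z] d_commute[of z y] unfolding gromov_product_def by (simp add: min_def max_def field_simps split: if_splits)

text \<open>
  Splitting a path into two halves costs one \<open>\<delta>\<close>. Hence a path of \<open>N\<close> steps that stays away from \<open>w\<close>
  loses only \<open>\<delta> * log N\<close> compared with a single step.
\<close>

lemma gromov_product_path:
  assumes "N \<le> 2 ^ e" "\<And>j. j < N \<Longrightarrow> d (x j) (x (Suc j)) \<le> K" "\<And>j. j \<le> N \<Longrightarrow> R \<le> d w (x j)" "K \<ge> 0"
  shows "R - K / 2 - real e * \<delta> \<le> gromov_product S w (x 0) (x N)"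
  using assms(1-3)
proof (induction e arbitrary: N x)
  case 0
  then have "N = 0 \<or> N = 1" by auto
  then show ?case using 0(2)[of 0] 0(3)[of 0] 0(3)[of 1] \<open>K \<ge> 0\<close>
    by (auto simp: gromov_product_def)
next
  case (Suc e)
  define M where "M = min N (2 ^ e)"
  have M: "M \<le> 2 ^ e" "N - M \<le> 2 ^ e" "M \<le> N" using Suc.prems(1) by (auto simp: M_def)
  have 1: "R - K / 2 - real e * \<delta> \<le> gromov_product S w (x 0) (x M)"
    using M by (intro Suc.IH Suc.prems) auto
  have "R - K / 2 - real e * \<delta> \<le> gromov_product S w (x (M + 0)) (x (M + (N - M)))"
    using M Suc.prems(2) Suc.prems(3) by (intro Suc.IH) auto
  then have 2: "R - K / 2 - real e * \<delta> \<le> gromov_product S w (x M) (x N)" using M by simp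
  show ?case using hyp[of w "x 0" "x M" "x N"] 1 2 by (simp add: algebra_simps min_def split: if_splits)
qed

text \<open>
  Up to an error \<open>O(\<delta>)\<close>, the Gromov product is the distance from \<open>w\<close> to a geodesic between the endpoints. So a
  path from \<open>x 0\<close> to \<open>x N\<close> passes near each point of the geodesic, with an error logarithmic in \<open>N\<close>.
\<close>

lemma geodesic_near_path:
  assumes "N \<le> 2 ^ e" "\<And>j. j < N \<Longrightarrow> d (x j) (x (Suc j)) \<le> K" "K \<ge> 0"
  obtains j where "j \<le> N" "d w (x j) \<le> gromov_product S w (x 0) (x N) + K / 2 + real e * \<delta>"
proof -
  obtain j where j: "j \<le> N" "\<And>i. i \<le> N \<Longrightarrow> d w (x j) \<le> d w (x i)"
    using ex_min_if_finite[of "(\<lambda>j. d w (x j)) ` {..N}"] by (auto simp: not_less)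
  have "d w (x j) - K / 2 - real e * \<delta> \<le> gromov_product S w (x 0) (x N)"
    using assms j by (intro gromov_product_path) auto
  with j show thesis by (intro that[of j]) auto
qed

lemma geodesic_point:
  assumes "t \<le> word_length S a"
  obtains z where "d a z = real t" "d z 0 = real (word_length S a) - real t"
proof -
  obtain w where w: "w \<in> lists S" "length w = word_length S a" "sum_list w = a"
    using word_of_minimal_length[OF gen] by metis
  define n where "n = length w - t"
  define z where "z = sum_list (take n w)"
  have aw: "a = z + sum_list (drop n w)" unfolding z_def
    by (metis append_take_drop_id sum_list_append w(3))
  have "set (take n w) \<subseteq> S" "set (drop n w) \<subseteq> S" using w(1) set_take_subset[of n w] set_drop_subset[of n w]
    by (auto simp: in_lists_conv_set)
  then have "word_length S z \<le> n" "word_length S (sum_list (drop n w)) \<le> t"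
    using word_length_sum_list_le[of "take n w" S] word_length_sum_list_le[of "drop n w" S] assms w(2)
    by (auto simp: n_def z_def in_lists_conv_set)
  moreover have "- z + a = sum_list (drop n w)" by (simp add: aw add.assoc[symmetric])
  ultimately have "d 0 z \<le> real n" "d z a \<le> real t" by (simp_all add: word_dist_def)
  moreover have "d 0 a = real (word_length S a)" by (simp add: word_dist_def)
  moreover have "real n = real (word_length S a) - real t" using assms w(2) by (simp add: n_def)
  ultimately have "d a z = real t" "d z 0 = real (word_length S a) - real t"
    using d_triangle[of 0 a z] d_commute[of a z] d_commute[of 0 z] by linarith+
  then show thesis by (rule that)
qed

text \<open>
  A shortest conjugator \<open>a\<close> between \<open>g\<close> and \<open>u\<close> is not much longer than \<open>g\<close> and \<open>u\<close> themselves. The reason is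
  that in the middle of a geodesic from \<open>a\<close> to \<open>0\<close> every point \<open>z\<close> is moved by \<open>g\<close> by at most
  \<open>6 * \<delta>\<close>: the point \<open>g + z\<close> is close to the geodesic since \<open>0\<close> and \<open>a\<close> are moved little, and it
  cannot be shifted along the geodesic since \<open>g + a\<close> and \<open>- g + a\<close> are no shorter conjugators than \<open>a\<close>.
  If the middle were longer than the number of elements of length \<open>6 * \<delta>\<close>, two of its points would have
  the same conjugate \<open>- z + g + z\<close>, and cutting out the piece between them would shorten \<open>a\<close>. It is
  essential here that \<open>6 * \<delta>\<close> does not depend on \<open>g\<close>: balls of logarithmic radius have polynomially many
  elements, and counting them would give only a polynomial bound.
\<close>

lemma conjugator_bound_small_displacement:
  assumes conj: "- a + g + a = u"
    and least: "\<And>b. - b + g + b = u \<Longrightarrow> word_length S a \<le> word_length S b"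
    and l: "d 0 g \<le> l" "d a (g + a) \<le> l"
  shows "real (word_length S a) \<le> 2 * l + 4 * \<delta> + real (card {v. word_length S v \<le> nat \<lceil>6 * \<delta>\<rceil>}) + 2"
proof -
  define T where "T = word_length S a"
  have d0: "d 0 b = real (word_length S b)" for b by (simp add: word_dist_def)
  have least': "real T \<le> d 0 b" if "- b + g + b = u" for b
    using least[OF that] by (simp add: d0 T_def)
  have T: "d 0 a = real T" "d a 0 = real T" using d_commute[of a 0] by (simp_all add: d0 T_def)
  have "- (g + a) + g + (g + a) = u"
    unfolding conj[symmetric] by (simp only: minus_add add.assoc minus_add_cancel)
  then have ga: "real T \<le> d 0 (g + a)" by (rule least')
  have "- (- g + a) + g + (- g + a) = u"
    unfolding conj[symmetric] by (simp only: minus_add minus_minus add.assoc add_minus_cancel)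
  then have ga': "real T \<le> d 0 (- g + a)" by (rule least')
  have l0: "0 \<le> l" using l(1) d_nonneg[of 0 g] by linarith
  define z where "z t = (SOME z. d a z = real t \<and> d z 0 = real T - real t)" for t
  have z: "d a (z t) = real t" "d (z t) 0 = real T - real t" if "t \<le> T" for t
  proof -
    have "\<exists>z. d a z = real t \<and> d z 0 = real T - real t"
      using geodesic_point[of t a] that unfolding T_def by metis
    then have "d a (z t) = real t \<and> d (z t) 0 = real T - real t"
      unfolding z_def by (rule someI_ex)
    then show "d a (z t) = real t" "d (z t) 0 = real T - real t" by blast+
  qed
  \<comment> \<open>The middle part of the geodesic omits \<open>m\<close> points at either end.\<close>
  define m where "m = nat \<lfloor>l + 2 * \<delta>\<rfloor> + 1"
  define M where "M = {m..<T - m}"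
  have m: "l + 2 * \<delta> < real m" "real m \<le> l + 2 * \<delta> + 1"
    using l0 \<delta>_nonneg unfolding m_def by linarith+
  have small: "- z t + g + z t \<in> {v. word_length S v \<le> nat \<lceil>6 * \<delta>\<rceil>}" if "t \<in> M" for t
  proof -
    have t: "t \<le> T" "l + 2 * \<delta> < real t" "real t < real T - l - 2 * \<delta>"
      using that m by (auto simp: M_def)
    let ?z = "z t" and ?y = "g + z t"
    have y: "d ?y (g + a) = real t" "d ?y (g + 0) = real T - real t"
      using z[OF t(1)] d_commute[of "z t"] by (simp_all only: d_left_invariant)
    have y': "d ?y g = real T - real t" using y(2) by simp
    have "gromov_product S ?y (g + a) g = 0"
      using y y' T(2) d_left_invariant[of g a 0] by (simp add: gromov_product_def)
    moreover have "gromov_product S ?y (g + a) a \<ge> real t - l"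
      using y(1) d_triangle[of ?y "g + a" a] d_triangle[of "g + a" "?y" a] l(2)
        d_commute[of "g + a" a] d_commute[of "?y" "g + a"] d_triangle[of "g + a" a ?y]
        d_commute[of a ?y]
      unfolding gromov_product_def by (simp add: field_simps)
    moreover have "gromov_product S ?y 0 g \<ge> real T - real t - l"
      using y' l(1) d_triangle[of ?y g 0] unfolding gromov_product_def by (simp add: field_simps)
    moreover have "gromov_product S ?y (g + a) g
        \<ge> min (gromov_product S ?y (g + a) a) (min (gromov_product S ?y a 0) (gromov_product S ?y 0 g)) - 2 * \<delta>"
      using hyp[where w="?y" and x="g + a" and y=a and z=g] hyp[where w="?y" and x=a and y=0 and z=g] \<delta>_nonneg
      by (simp add: min_def split: if_splits)
    ultimately have "gromov_product S ?y a 0 \<le> 2 * \<delta>"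
      using t by (simp add: min_def split: if_splits)
    then have sum: "d a ?y + d 0 ?y \<le> real T + 4 * \<delta>"
      using T(2) d_commute[of "?y"] by (simp add: gromov_product_def)
    \<comment> \<open>Minimality of \<open>a\<close> excludes a shift along the geodesic in either direction.\<close>
    have "d a ?y = d (- g + a) (z t)"
      using d_left_invariant[of g "- g + a" "z t"] by (simp add: add.assoc[symmetric])
    then have "real t \<le> d a ?y"
      using ga' d_triangle[of 0 "- g + a" "z t"] z[OF t(1)] 
        d_commute[of "z t" 0] d_commute[of "z t" "- g + a"] by linarith
    moreover have "real T - real t \<le> d 0 ?y"
      using ga d_triangle[of 0 "g + a" ?y] y(1) by linarith
    moreover have "d a 0 + d ?z ?y \<le> max (d a ?z + d 0 ?y) (d a ?y + d ?z 0) + 2 * \<delta>"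
      using four_point[of a 0 ?z ?y] d_commute[of 0 ?y] by simp
    ultimately have "d ?z ?y \<le> 6 * \<delta>" using sum T(2) z[OF t(1)] by linarith
    then show ?thesis by (simp add: word_dist_def add.assoc le_nat_iff ceiling_le_iff) linarith
  qed
  have inj: "inj_on (\<lambda>t. - z t + g + z t) M"
  proof (rule linorder_inj_onI)
    fix s t assume st: "s < t" "s \<in> M" "t \<in> M"
    show "- z s + g + z s \<noteq> - z t + g + z t"
    proof
      assume eq: "- z s + g + z s = - z t + g + z t"
      \<comment> \<open>The element \<open>z t - z s\<close> commutes with \<open>g\<close>, so \<open>?b\<close> conjugates \<open>g\<close> to \<open>u\<close> as \<open>a\<close> does, but is shorter.\<close>
      let ?b = "z t + (- z s + a)"
      have "- ?b + g + ?b = - a + z s + (- z t + g + z t) + - z s + a"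
        by (simp only: minus_add minus_minus add.assoc)
      also have "\<dots> = u"
        unfolding eq[symmetric] conj[symmetric] by (simp only: add.assoc add_minus_cancel)
      finally have "real T \<le> d 0 ?b" by (rule least')
      also have "\<dots> \<le> d 0 (z t) + d (z t) ?b" by (rule d_triangle)
      also have "d (z t) ?b = d (z s) a"
        using d_left_invariant[of "z t" 0 "- z s + a"] d_left_invariant[of "- z s" "z s" a] by simp
      also have "d 0 (z t) + d (z s) a = real T - real t + real s"
        using z[of t] z[of s] st d_commute[of 0 "z t"] d_commute[of "z s" a] by (simp add: M_def)
      finally show False using st(1) by simp
    qed
  qed auto
  have "card M \<le> card {v. word_length S v \<le> nat \<lceil>6 * \<delta>\<rceil>}"
    using inj small ball_growth(1)[OF gen] by (intro card_inj_on_le) auto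
  moreover have "real T - 2 * real m \<le> real (card M)" unfolding M_def by simp
  ultimately show ?thesis using m unfolding T_def by linarith
qed

text \<open>
  Here \<open>S\<close> is a generating set for which the four-point condition holds and \<open>X\<close> is the one with respect
  to which \<open>u\<close> is shortest in its conjugacy class. The path \<open>x\<close> runs from \<open>0\<close> to \<open>g\<close>, and \<open>a\<close> is, among
  all conjugators from \<open>g\<close> to \<open>u\<close>, one that comes closest to this path, the distance being attained at its
  start \<open>0\<close>.

  Since \<open>a\<close> and \<open>g + a\<close> are at distance at least \<open>d 0 a\<close> from the path, the geodesics from \<open>a\<close> to \<open>0\<close> and
  from \<open>a\<close> to \<open>g\<close> run together for almost the length \<open>d 0 a\<close>, and likewise at \<open>g + a\<close>. The four-point
  condition for \<open>a, g, 0, g + a\<close> leaves two possibilities. Either \<open>g\<close> is of logarithmic length, and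
  the preceding lemma applies. Or a geodesic from \<open>a\<close> to \<open>g + a\<close> makes a detour: it travels from \<open>a\<close> to a
  point near \<open>0\<close>, on to a point near \<open>g\<close>, and back to \<open>g + a\<close>. The points \<open>q j = a + u_1 + ... + u_j\<close>
  along a shortest word of \<open>u\<close> must then come close to \<open>0\<close> and to \<open>g\<close>. The cyclic permutations of this word
  cannot be shortened, so such a detour is short, and \<open>a\<close> itself is close to \<open>0\<close> or to \<open>g\<close>.
\<close>

lemma conjugator_bound:
  assumes X: "symmetric_generating_set X"
    and A: "A \<ge> 1" "\<And>v. real (word_length X v) \<le> A * real (word_length S v)"
       "\<And>v. real (word_length S v) \<le> A * real (word_length X v)"
    and path: "x 0 = 0" "x N = g" "N \<le> 2 ^ e" "\<And>j. j < N \<Longrightarrow> d (x j) (x (Suc j)) \<le> K" "K \<ge> 0"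
    and u: "word_length X u \<le> 2 ^ e'" "\<And>v. v \<in> conj_class u \<Longrightarrow> word_length X u \<le> word_length X v"
    and conj: "- a + g + a = u"
    and least: "\<And>j b. j \<le> N \<Longrightarrow> - b + g + b = u \<Longrightarrow> d 0 a \<le> d (x j) b"
  defines "D \<equiv> K / 2 + real e * \<delta>"
  shows "d 0 a \<le> max (2 * (A\<^sup>2 * (2 * D + \<delta>)) + 4 * \<delta> + real (card {v. word_length S v \<le> nat \<lceil>6 * \<delta>\<rceil>}) + 2)
                    ((2 * A\<^sup>2 + 1) * (D + \<delta> + A / 2 + real e' * \<delta>))"
proof -
  define T where "T = d 0 a"
  have D: "D \<ge> 0" using \<open>K \<ge> 0\<close> \<delta>_nonneg by (simp add: D_def)
  have conj': "- (g + a) + g + (g + a) = u"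
    unfolding conj[symmetric] by (simp only: minus_add add.assoc minus_add_cancel)
  have T: "d a 0 = T" "d g (g + a) = T"
    using d_left_invariant[of g 0 a] by (simp_all add: T_def d_commute[of a 0])
  have far: "T \<le> d b (x j)" if "j \<le> N" "- b + g + b = u" for j b
    using least[OF that] d_commute[of b] by (simp add: T_def)
  have prod: "T - D \<le> gromov_product S b 0 g" if "- b + g + b = u" for b
    using gromov_product_path[of N e x K T b] path far that by (simp add: D_def)
  have 1: "d 0 g + T \<le> d a g + 2 * D"
    using prod[OF conj] T(1) by (simp add: gromov_product_def field_simps)
  have 2: "d 0 g + T \<le> d 0 (g + a) + 2 * D"
    using prod[OF conj'] T(2) d_commute[of "g + a"] by (simp add: gromov_product_def field_simps)
  have ag: "T \<le> d a g" using far[of N a] conj path(2) by simp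
  have "d a g + d 0 (g + a) \<le> max (d a 0 + d g (g + a)) (d a (g + a) + d 0 g) + 2 * \<delta>"
    using four_point[of a g 0 "g + a"] by simp
  then consider "d a g + d 0 (g + a) \<le> 2 * T + 2 * \<delta>"
    | "d a g + d 0 (g + a) \<le> d a (g + a) + d 0 g + 2 * \<delta>"
    using T by (auto simp: max_def split: if_splits)
  then show ?thesis
  proof cases
    case 1
    then have g: "d 0 g \<le> 2 * D + \<delta>" using \<open>d 0 g + T \<le> d a g + 2 * D\<close> 2 by linarith
    have g_u: "g \<in> conj_class u"
      using conjugate_in_conj_class[of "- a" u] unfolding conj[symmetric]
      by (simp only: minus_minus add.assoc add_minus_cancel minus_add_cancel) simp
    have "d a (g + a) = real (word_length S u)"
      by (simp add: word_dist_def conj[symmetric] add.assoc)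
    also have "\<dots> \<le> A * real (word_length X g)"
      using A(3)[of u] u(2)[OF g_u] A(1) by (meson mult_left_mono of_nat_le_iff order_trans zero_le_one)
    also have "\<dots> \<le> A * (A * d 0 g)"
      using A(2)[of g] A(1) by (intro mult_left_mono) (auto simp: word_dist_def)
    also have "\<dots> \<le> A\<^sup>2 * (2 * D + \<delta>)"
      using g A(1) by (simp add: power2_eq_square mult.assoc mult_left_mono)
    finally have l2: "d a (g + a) \<le> A\<^sup>2 * (2 * D + \<delta>)" .
    have "1 * (2 * D + \<delta>) \<le> A\<^sup>2 * (2 * D + \<delta>)"
      using A(1) D \<delta>_nonneg by (intro mult_right_mono) (auto intro: one_le_power)
    with g have l1: "d 0 g \<le> A\<^sup>2 * (2 * D + \<delta>)" by simp
    have "word_length S a \<le> word_length S b" if "- b + g + b = u" for b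
      using least[of 0 b] that path(1) by (simp add: word_dist_def)
    from conjugator_bound_small_displacement[OF conj this l1 l2]
    show ?thesis by (simp add: word_dist_def)
  next
    case case2: 2
    define G where "G = D + \<delta> + A / 2 + real e' * \<delta>"
    obtain w where w: "w \<in> lists X" "length w = word_length X u" "sum_list w = u"
      using word_of_minimal_length[OF X] by metis
    define L where "L = length w"
    define q where "q j = a + sum_list (take j w)" for j
    \<comment> \<open>A segment of the word \<open>w\<close> represents the quotient of two of its prefixes.\<close>
    have X1: "word_length X (- sum_list (take j w) + sum_list (take k w)) \<le> k - j" if "j \<le> k" "k \<le> L" for j k
    proof -
      have "take k w = take j w @ drop j (take k w)" using that
        by (metis append_take_drop_id min.absorb1 take_take)
      then have "sum_list (take k w) = sum_list (take j w) + sum_list (drop j (take k w))"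
        by (metis sum_list_append)
      then have eq: "- sum_list (take j w) + sum_list (take k w) = sum_list (drop j (take k w))"
        by (simp only: minus_add_cancel)
      have "drop j (take k w) \<in> lists X" using w(1)
        by (meson in_lists_conv_set in_set_dropD in_set_takeD)
      from word_length_sum_list_le[OF this] that show ?thesis unfolding eq by (simp add: L_def)
    qed
    have qX: "- q j + q k = - sum_list (take j w) + sum_list (take k w)" for j k
      by (simp only: q_def minus_add add.assoc minus_add_cancel)
    have step: "d (q j) (q k) \<le> A * real (k - j)" if "j \<le> k" "k \<le> L" for j k
      using A(3)[of "- q j + q k"] X1[OF that] A(1) unfolding qX word_dist_def
      by (meson mult_left_mono of_nat_le_iff order_trans zero_le_one)
    have q0: "q 0 = a" by (simp add: q_def)
    have "a + u = g + a" unfolding conj[symmetric] by (simp only: add.assoc add_minus_cancel)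
    then have qL: "q L = g + a" by (simp add: q_def L_def w)
    have LN: "L \<le> 2 ^ e'" using u(1) w(2) by (simp add: L_def)
    have stepA: "d (q j) (q (Suc j)) \<le> A" if "j < L" for j using step[of j "Suc j"] that by simp
    have "A \<ge> 0" using A(1) by simp
    have P0: "gromov_product S 0 a (g + a) \<le> D + \<delta>"
      using case2 1 by (simp add: gromov_product_def T_def[symmetric] field_simps)
    obtain j where "j \<le> L" "d 0 (q j) \<le> gromov_product S 0 (q 0) (q L) + A / 2 + real e' * \<delta>"
      by (rule geodesic_near_path[where x=q and w=0, OF LN stepA \<open>A \<ge> 0\<close>])
    with P0 have j: "j \<le> L" "d 0 (q j) \<le> G" unfolding q0 qL G_def by linarith+
    have Pg: "gromov_product S g a (g + a) \<le> D + \<delta>"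
      using case2 2 T(2) d_commute[of g a] by (simp add: gromov_product_def field_simps)
    obtain k where "k \<le> L" "d g (q k) \<le> gromov_product S g (q 0) (q L) + A / 2 + real e' * \<delta>"
      by (rule geodesic_near_path[where x=q and w=g, OF LN stepA \<open>A \<ge> 0\<close>])
    with Pg have k: "k \<le> L" "d g (q k) \<le> G" unfolding q0 qL G_def by linarith+
    have G: "G \<ge> 0" using j(2) d_nonneg[of 0 "q j"] by linarith
    \<comment> \<open>The displacement of \<open>q j\<close> is the length of a conjugate of \<open>u\<close>, hence at least \<open>L\<close>. But \<open>g + q j\<close> is near
      \<open>q k\<close>, so \<open>L\<close> is at most \<open>\<bar>j - k\<bar>\<close> up to a logarithmic error.\<close>
    have "- q j + (g + q j) = - sum_list (take j w) + u + sum_list (take j w)"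
      unfolding q_def conj[symmetric] by (simp only: minus_add add.assoc)
    then have "- q j + (g + q j) \<in> conj_class u"
      using conjugate_in_conj_class[of "sum_list (take j w)" u] by simp
    then have "L \<le> word_length X (- q j + (g + q j))" using u(2) w(2) by (simp add: L_def)
    also have "\<dots> \<le> word_length X (- q j + q k) + word_length X (- q k + (g + q j))"
      using word_length_add_le[OF X, of "- q j + q k" "- q k + (g + q j)"]
      by (simp only: add.assoc add_minus_cancel)
    finally have L: "real L \<le> real (word_length X (- q j + q k)) + real (word_length X (- q k + (g + q j)))"
      by linarith
    have "real (word_length X (- q k + (g + q j))) \<le> A * d (q k) (g + q j)"
      using A(2) by (simp add: word_dist_def)
    also have "d (q k) (g + q j) \<le> 2 * G"
      using d_triangle[of "q k" "g + q j" g] d_commute[of "q k" g] k(2) j(2) d_left_invariant[of g 0 "q j"]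
      by simp
    finally have L2: "real (word_length X (- q k + (g + q j))) \<le> 2 * (A * G)"
      using A(1) by (simp add: mult_left_mono)
    have "T \<le> G + A * (2 * (A * G))"
    proof (cases "j \<le> k")
      case True
      have "real j \<le> 2 * (A * G)" using L L2 X1[OF True k(1)] k(1) True unfolding qX by linarith
      then have "A * real j \<le> A * (2 * (A * G))" using A(1) by (intro mult_left_mono) auto
      then show ?thesis
        using d_triangle[of 0 a "q j"] j step[of 0 j] d_commute[of a "q j"] unfolding q0 T_def[symmetric] by simp
    next
      case False
      have "word_length X (- q j + q k) = word_length X (- q k + q j)"
        using word_length_minus[OF X, of "- q k + q j"] by (simp only: minus_add minus_minus)
      then have "real k \<le> 2 * (A * G)" using L L2 X1[of k j] j(1) False unfolding qX by linarith
      then have "A * real k \<le> A * (2 * (A * G))" using A(1) by (intro mult_left_mono) auto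
      then show ?thesis
        using d_triangle[of a g "q k"] k step[of 0 k] d_commute[of g "q k"] ag unfolding q0 by simp
    qed
    also have "G + A * (2 * (A * G)) = (2 * A\<^sup>2 + 1) * G" by (simp add: power2_eq_square algebra_simps)
    finally show ?thesis unfolding T_def G_def by simp
  qed
qed

end

text \<open>
  All choices of a cyclic permutation and of a conjugator are compared at once, and the shortest
  conjugator is taken; replacing the word by its cyclic permutation puts it into the situation of
  \<open>conjugator_bound\<close>.
\<close>

lemma logarithmic_conjugator:
  fixes X :: "'g::group_add set"
  assumes hyp: "word_hyperbolic TYPE('g)"
    and X: "symmetric_generating_set X"
    and h: "\<forall>x. h (conj_class x) \<in> conj_class x \<and>
              (\<forall>y\<in>conj_class x. word_length X (h (conj_class x)) \<le> word_length X y)"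
  obtains C where "\<And>e gs. length gs \<le> 2 ^ e \<Longrightarrow> gs \<noteq> [] \<Longrightarrow> (\<And>g. g \<in> set gs \<Longrightarrow> word_length X g \<le> n) \<Longrightarrow>
     \<exists>i<length gs. \<exists>y. word_length X y \<le> C * (e + 1) \<and>
        h (conj_class (sum_list gs)) = - y + sum_list (rotate i gs) + y"
proof -
  from hyp obtain S :: "'g set" and \<delta> where S: "symmetric_generating_set S"
    "\<forall>w x y z. gromov_product S w x z \<ge> min (gromov_product S w x y) (gromov_product S w y z) - \<delta>"
    unfolding word_hyperbolic_def by blast
  then interpret hyperbolic_word_metric S \<delta> by unfold_locales blast+
  obtain A1 where A1: "\<And>g. word_length X g \<le> A1 * word_length S g"
    using word_lengths_comparable[OF X S(1)] by metis
  obtain A2 where A2: "\<And>g. word_length S g \<le> A2 * word_length X g"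
    using word_lengths_comparable[OF S(1) X] by metis
  define A where "A = real (A1 + A2 + 1)"
  have A: "A \<ge> 1" by (simp add: A_def)
  have AX: "real (word_length X v) \<le> A * real (word_length S v)" for v
  proof -
    have "A1 * word_length S v \<le> (A1 + A2 + 1) * word_length S v" by (intro mult_right_mono) auto
    then show ?thesis using A1[of v] unfolding A_def by (metis of_nat_le_iff of_nat_mult order_trans)
  qed
  have AS: "real (word_length S v) \<le> A * real (word_length X v)" for v
  proof -
    have "A2 * word_length X v \<le> (A1 + A2 + 1) * word_length X v" by (intro mult_right_mono) auto
    then show ?thesis using A2[of v] unfolding A_def by (metis of_nat_le_iff of_nat_mult order_trans)
  qed
  define K where "K = A * real n"
  have K: "K \<ge> 0" using A by (simp add: K_def)
  define c where "c = real (card {v. word_length S v \<le> nat \<lceil>6 * \<delta>\<rceil>})"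
  have linear: "\<alpha> + \<beta> * real e \<le> (\<alpha> + \<beta>) * (real e + 1)" if "\<alpha> \<ge> 0" "\<beta> \<ge> 0" for \<alpha> \<beta> e
    using that by (simp add: algebra_simps)
  \<comment> \<open>\<open>C1\<close> and \<open>C2\<close> come from the two bounds of \<open>conjugator_bound\<close>, which are affine in \<open>e\<close>; the exponent
    there for the length of \<open>u\<close> is \<open>e + n\<close> because \<open>n * 2^e \<le> 2^(e + n)\<close>.\<close>
  define C1 where "C1 = (2 * A\<^sup>2 * (K + \<delta>) + 4 * \<delta> + c + 2) + 4 * A\<^sup>2 * \<delta>"
  define C2 where "C2 = (2 * A\<^sup>2 + 1) * (K / 2 + \<delta> + A / 2 + real n * \<delta>) + (2 * A\<^sup>2 + 1) * (2 * \<delta>)"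
  have bound: "max (2 * (A\<^sup>2 * (2 * (K / 2 + real e * \<delta>) + \<delta>)) + 4 * \<delta> + c + 2)
                    ((2 * A\<^sup>2 + 1) * ((K / 2 + real e * \<delta>) + \<delta> + A / 2 + real (e + n) * \<delta>))
      \<le> max C1 C2 * (real e + 1)" for e
  proof -
    have "2 * (A\<^sup>2 * (2 * (K / 2 + real e * \<delta>) + \<delta>)) + 4 * \<delta> + c + 2 =
       (2 * A\<^sup>2 * (K + \<delta>) + 4 * \<delta> + c + 2) + (4 * A\<^sup>2 * \<delta>) * real e" by (simp add: algebra_simps)
    also have "\<dots> \<le> C1 * (real e + 1)" unfolding C1_def
      using \<delta>_nonneg K by (intro linear add_nonneg_nonneg mult_nonneg_nonneg) (auto simp: c_def)
    also have "\<dots> \<le> max C1 C2 * (real e + 1)" by (intro mult_right_mono) auto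
    finally have 1: "2 * (A\<^sup>2 * (2 * (K / 2 + real e * \<delta>) + \<delta>)) + 4 * \<delta> + c + 2 \<le> max C1 C2 * (real e + 1)" .
    have "(2 * A\<^sup>2 + 1) * ((K / 2 + real e * \<delta>) + \<delta> + A / 2 + real (e + n) * \<delta>) =
       (2 * A\<^sup>2 + 1) * (K / 2 + \<delta> + A / 2 + real n * \<delta>) + ((2 * A\<^sup>2 + 1) * (2 * \<delta>)) * real e"
      by (simp add: algebra_simps)
    also have "\<dots> \<le> C2 * (real e + 1)" unfolding C2_def
      using \<delta>_nonneg K A by (intro linear add_nonneg_nonneg mult_nonneg_nonneg) auto
    also have "\<dots> \<le> max C1 C2 * (real e + 1)" by (intro mult_right_mono) auto
    finally show ?thesis using 1 by simp
  qed
  define C where "C = nat \<lceil>A * max C1 C2\<rceil>"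
  show thesis
  proof (rule that[of C])
    fix e and gs :: "'g list"
    assume len: "length gs \<le> 2 ^ e" and ne: "gs \<noteq> []" and gs: "\<And>g. g \<in> set gs \<Longrightarrow> word_length X g \<le> n"
    define u where "u = h (conj_class (sum_list gs))"
    have "u \<in> conj_class (sum_list gs)" using h unfolding u_def by blast
    then obtain y where y: "u = y + sum_list gs - y" unfolding conj_class_def by blast
    have cu: "conj_class u = conj_class (sum_list gs)"
      using conj_class_conjugate[of "- y" "sum_list gs"] y by simp
    define P where "P = (\<lambda>(i, b). - b + sum_list (rotate i gs) + b = u)"
    have "P (0, - y)" by (simp add: P_def y)
    then obtain i a where ia: "P (i, a)" and min: "\<And>j b. P (j, b) \<Longrightarrow> word_length S a \<le> word_length S b"
      using ex_has_least_nat[of P _ "\<lambda>(i, b). word_length S b"] by fastforce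
    define gs' where "gs' = rotate i gs"
    define x where "x j = sum_list (take j gs')" for j
    define g where "g = sum_list gs'"
    have conj: "- a + g + a = u" using ia by (simp add: P_def g_def gs'_def)
    have len': "length gs' = length gs" by (simp add: gs'_def)
    have le: "d 0 a \<le> d (x j) b" if "j \<le> length gs" "- b + g + b = u" for j b
    proof -
      have "sum_list (rotate (j + i) gs) = - x j + g + x j"
        using sum_list_rotate_conjugate[of j gs'] that(1) len'
        by (simp add: gs'_def x_def g_def rotate_rotate)
      then have "- (- x j + b) + sum_list (rotate (j + i) gs) + (- x j + b) = - b + g + b"
        by (simp only: minus_add minus_minus add.assoc add_minus_cancel)
      then have "P (j + i, - x j + b)" using that(2) by (simp only: P_def prod.case)
      from min[OF this] show ?thesis by (simp add: word_dist_def)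
    qed
    have step: "d (x j) (x (Suc j)) \<le> K" if "j < length gs" for j
    proof -
      have "gs' ! j \<in> set gs" using nth_mem[of j gs'] that len' by (simp add: gs'_def)
      then have "A * real (word_length X (gs' ! j)) \<le> K"
        unfolding K_def using gs A by (intro mult_left_mono) auto
      moreover have "- x j + x (Suc j) = gs' ! j"
        using that len' by (simp add: x_def take_Suc_conv_app_nth add.assoc[symmetric])
      ultimately show ?thesis using AS[of "gs' ! j"] by (simp add: word_dist_def)
    qed
    have "word_length X u \<le> word_length X (sum_list gs)"
      using h conjugate_in_conj_class[of 0 "sum_list gs"] unfolding u_def by simp
    also have "\<dots> \<le> n * length gs" using word_length_sum_list_bound[OF X, of gs n] gs by blast
    also have "\<dots> \<le> 2 ^ n * 2 ^ e" using len by (intro mult_mono) auto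
    finally have u: "word_length X u \<le> 2 ^ (e + n)" by (simp add: power_add mult.commute)
    have umin: "word_length X u \<le> word_length X v" if "v \<in> conj_class u" for v
      using h that[unfolded cu] unfolding u_def by blast
    have x0: "x 0 = 0" and xN: "x (length gs) = g" using len' by (simp_all add: x_def g_def)
    have "d 0 a \<le> max C1 C2 * (real e + 1)"
      using conjugator_bound[where x=x, OF X A AX AS x0 xN len step K u umin conj le, folded c_def] bound[of e]
      by (rule order_trans)
    then have "A * real (word_length S a) \<le> A * (max C1 C2 * (real e + 1))"
      using A by (intro mult_left_mono) (auto simp: word_dist_def)
    with AX[of a] have "real (word_length X a) \<le> A * (max C1 C2 * (real e + 1))"
      by (rule order_trans)
    also have "\<dots> = (A * max C1 C2) * (real e + 1)" by (rule mult.assoc[symmetric])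
    also have "\<dots> \<le> real C * (real e + 1)"
      unfolding C_def by (intro mult_right_mono real_nat_ceiling_ge) simp
    finally have "real (word_length X a) \<le> real (C * (e + 1))" by (simp add: distrib_left)
    then have a: "word_length X a \<le> C * (e + 1)" by (simp only: of_nat_le_iff)
    have "h (conj_class (sum_list gs)) = - a + sum_list (rotate (i mod length gs) gs) + a"
      using conj rotate_conv_mod[of i gs] by (simp add: u_def g_def gs'_def)
    moreover have "i mod length gs < length gs" using ne by simp
    ultimately show "\<exists>i<length gs. \<exists>y. word_length X y \<le> C * (e + 1) \<and>
        h (conj_class (sum_list gs)) = - y + sum_list (rotate i gs) + y"
      using a by (intro exI[of _ "i mod length gs"] exI[of _ a] conjI)
  qed
qed

section \<open>Unconditional seminorms and positive maps on the group ring\<close>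

abbreviation dominated :: "'g group_ring \<Rightarrow> 'g group_ring \<Rightarrow> bool" (infix "\<preceq>" 50) where
  "a \<preceq> b \<equiv> \<forall>x. cmod (Poly_Mapping.lookup a x) \<le> cmod (Poly_Mapping.lookup b x)"

abbreviation gr_basis :: "'g \<Rightarrow> 'g group_ring" where
  "gr_basis g \<equiv> Poly_Mapping.single g 1"

lemma lookup_gr_scale [simp]: "Poly_Mapping.lookup (gr_scale c a) x = c * Poly_Mapping.lookup a x"
  by (simp add: gr_scale_def map.rep_eq when_def)

lemma lookup_gr_abs [simp]:
  "Poly_Mapping.lookup (gr_abs a) x = complex_of_real (cmod (Poly_Mapping.lookup a x))"
  by (simp add: gr_abs_def map.rep_eq when_def)

lemma gr_abs_idem [simp]: "gr_abs (gr_abs a) = gr_abs a"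
  by (rule poly_mapping_eqI) simp

lemma keys_gr_abs [simp]: "Poly_Mapping.keys (gr_abs a) = Poly_Mapping.keys a"
  by (auto simp: in_keys_iff)

lemma gr_abs_single [simp]: "gr_abs (Poly_Mapping.single g c) = Poly_Mapping.single g (complex_of_real (cmod c))"
  by (rule poly_mapping_eqI) (simp add: lookup_single when_def)

lemma gr_abs_scale: "gr_abs (gr_scale c a) = gr_scale (complex_of_real (cmod c)) (gr_abs a)"
  by (rule poly_mapping_eqI) (simp add: norm_mult)

lemma gr_abs_eqI:
  assumes "\<And>x. \<exists>r\<ge>0. Poly_Mapping.lookup a x = complex_of_real r"
  shows "gr_abs a = a"
proof (rule poly_mapping_eqI)
  fix x show "Poly_Mapping.lookup (gr_abs a) x = Poly_Mapping.lookup a x"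
    using assms[of x] by auto
qed

lemma gr_abs_add_fixed: "gr_abs (gr_abs a + gr_abs b) = gr_abs a + gr_abs b"
proof (rule gr_abs_eqI)
  fix x show "\<exists>r\<ge>0. Poly_Mapping.lookup (gr_abs a + gr_abs b) x = complex_of_real r"
    by (intro exI[of _ "cmod (Poly_Mapping.lookup a x) + cmod (Poly_Mapping.lookup b x)"]) (simp add: lookup_add)
qed

lemma sum_of_singles:
  assumes "finite K" "Poly_Mapping.keys a \<subseteq> K"
  shows "(\<Sum>g\<in>K. Poly_Mapping.single g (Poly_Mapping.lookup a g)) = a"
proof (rule poly_mapping_eqI)
  fix x
  have "Poly_Mapping.lookup a x = 0" if "x \<notin> K" using assms(2) that by (meson in_keys_iff subset_iff)
  then show "Poly_Mapping.lookup (\<Sum>g\<in>K. Poly_Mapping.single g (Poly_Mapping.lookup a g)) x = Poly_Mapping.lookup a x"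
    using assms(1) by (auto simp: lookup_sum lookup_single when_def if_distrib sum.delta cong: if_cong)
qed

lemma lookup_single_mult:
  "Poly_Mapping.lookup (Poly_Mapping.single l c * b) x = c * Poly_Mapping.lookup b (- l + x)"
  for b :: "'g::group_add group_ring"
proof -
  have "Poly_Mapping.single l c * b = Poly_Mapping.single l c *
      (\<Sum>q\<in>Poly_Mapping.keys b. Poly_Mapping.single q (Poly_Mapping.lookup b q))"
    by (simp add: sum_of_singles)
  also have "\<dots> = (\<Sum>q\<in>Poly_Mapping.keys b. Poly_Mapping.single (l + q) (c * Poly_Mapping.lookup b q))"
    by (simp add: sum_distrib_left mult_single)
  finally have "Poly_Mapping.lookup (Poly_Mapping.single l c * b) x =
      (\<Sum>q\<in>Poly_Mapping.keys b. if l + q = x then c * Poly_Mapping.lookup b q else 0)"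
    by (simp add: lookup_sum lookup_single when_def)
  also have "\<dots> = (\<Sum>q\<in>Poly_Mapping.keys b. if q = - l + x then c * Poly_Mapping.lookup b q else 0)"
    by (intro sum.cong) (auto simp: add.assoc[symmetric])
  also have "\<dots> = c * Poly_Mapping.lookup b (- l + x)"
    by (auto simp: sum.delta in_keys_iff)
  finally show ?thesis .
qed

lemma lookup_mult_group:
  fixes a b :: "'g::group_add group_ring"
  assumes "finite K" "Poly_Mapping.keys a \<subseteq> K"
  shows "Poly_Mapping.lookup (a * b) x = (\<Sum>l\<in>K. Poly_Mapping.lookup a l * Poly_Mapping.lookup b (- l + x))"
proof -
  have "a * b = (\<Sum>l\<in>K. Poly_Mapping.single l (Poly_Mapping.lookup a l) * b)"
    using sum_of_singles[OF assms] by (metis sum_distrib_right)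
  then show ?thesis by (simp add: lookup_sum lookup_single_mult)
qed

lemma gr_scale_mult_left: "gr_scale c a * b = gr_scale c (a * b)"
  for a b :: "'g::group_add group_ring"
proof (rule poly_mapping_eqI)
  fix x
  have "Poly_Mapping.keys (gr_scale c a) \<subseteq> Poly_Mapping.keys a" by (auto simp: in_keys_iff)
  then show "Poly_Mapping.lookup (gr_scale c a * b) x = Poly_Mapping.lookup (gr_scale c (a * b)) x"
    by (simp add: lookup_mult_group[where K="Poly_Mapping.keys a"] sum_distrib_left mult.assoc)
qed

lemma gr_scale_mult_right: "a * gr_scale c b = gr_scale c (a * b)"
  for a b :: "'g::group_add group_ring"
  by (rule poly_mapping_eqI)
    (simp add: lookup_mult_group[where K="Poly_Mapping.keys a"] sum_distrib_left mult.left_commute)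

lemma gr_abs_mult_fixed: "gr_abs (gr_abs a * gr_abs b) = gr_abs a * gr_abs b"
  for a b :: "'g::group_add group_ring"
proof (rule gr_abs_eqI)
  fix x show "\<exists>r\<ge>0. Poly_Mapping.lookup (gr_abs a * gr_abs b) x = complex_of_real r"
    by (intro exI[of _ "\<Sum>l\<in>Poly_Mapping.keys a. cmod (Poly_Mapping.lookup a l) * cmod (Poly_Mapping.lookup b (- l + x))"])
      (simp add: lookup_mult_group[where K="Poly_Mapping.keys a"] sum_nonneg)
qed

lemma mult_dominated:
  fixes a b a' b' :: "'g::group_add group_ring"
  assumes "a \<preceq> a'" "b \<preceq> b'"
  shows "a * b \<preceq> gr_abs a' * gr_abs b'"
proof
  fix x
  let ?K = "Poly_Mapping.keys a'"
  have "Poly_Mapping.keys a \<subseteq> ?K"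
  proof
    fix y assume "y \<in> Poly_Mapping.keys a"
    then show "y \<in> ?K" using assms(1) by (metis in_keys_iff norm_le_zero_iff norm_zero)
  qed
  then have "cmod (Poly_Mapping.lookup (a * b) x) =
      cmod (\<Sum>l\<in>?K. Poly_Mapping.lookup a l * Poly_Mapping.lookup b (- l + x))"
    by (simp add: lookup_mult_group[where K="?K"])
  also have "\<dots> \<le> (\<Sum>l\<in>?K. cmod (Poly_Mapping.lookup a' l) * cmod (Poly_Mapping.lookup b' (- l + x)))"
    using assms by (intro sum_norm_le) (simp add: norm_mult mult_mono)
  also have "\<dots> = cmod (complex_of_real (\<Sum>l\<in>?K. cmod (Poly_Mapping.lookup a' l) * cmod (Poly_Mapping.lookup b' (- l + x))))"
    by (subst norm_of_real) (simp add: sum_nonneg)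
  also have "\<dots> = cmod (Poly_Mapping.lookup (gr_abs a' * gr_abs b') x)"
    by (simp add: lookup_mult_group[where K="?K"])
  finally show "cmod (Poly_Mapping.lookup (a * b) x) \<le> \<dots>" .
qed

lemma unconditional_seminormD:
  assumes "unconditional_seminorm p"
  shows "p (a + b) \<le> p a + p b" "p (gr_scale c a) = cmod c * p a" "a \<preceq> b \<Longrightarrow> p a \<le> p b"
    "p 0 = 0" "0 \<le> p a" "p (gr_abs a) = p a" "p (a - b) \<le> p a + p b"
proof -
  show 1: "p (a + b) \<le> p a + p b" and 2: "p (gr_scale c a) = cmod c * p a"
    and 3: "a \<preceq> b \<Longrightarrow> p a \<le> p b" for a b c
    using assms unfolding unconditional_seminorm_def is_seminorm_def by blast+
  have "gr_scale 0 0 = (0 :: 'a group_ring)" by (rule poly_mapping_eqI) simp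
  then show 4: "p 0 = 0" using 2[of 0 0] by simp
  show "0 \<le> p a" using 3[of 0 a] 4 by simp
  show "p (gr_abs a) = p a" by (intro antisym 3) simp_all
  have "p (- b) \<le> p b" by (rule 3) simp
  then show "p (a - b) \<le> p a + p b" using 1[of a "- b"] by simp
qed

lemma unconditional_seminorm_sum:
  assumes "unconditional_seminorm p"
  shows "p (\<Sum>i\<in>I. f i) \<le> (\<Sum>i\<in>I. p (f i))"
proof (induction I rule: infinite_finite_induct)
  case (insert i I)
  then show ?case using unconditional_seminormD(1)[OF assms, of "f i" "sum f I"] by simp
qed (simp_all add: unconditional_seminormD[OF assms])

text \<open>
  For \<open>b = a\<close> the last condition says that \<open>|\<phi> a| \<le> |\<phi> |a||\<close>. In the form used here the condition makes
  \<open>a \<mapsto> f (\<phi> |a|)\<close> unconditional whenever \<open>f\<close> is.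
\<close>

definition positive_map :: "('g group_ring \<Rightarrow> 'g group_ring) \<Rightarrow> bool" where
  "positive_map \<phi> \<longleftrightarrow> (\<forall>a b. \<phi> (a + b) = \<phi> a + \<phi> b) \<and> (\<forall>c a. \<phi> (gr_scale c a) = gr_scale c (\<phi> a)) \<and>
     (\<forall>a b. a \<preceq> b \<longrightarrow> \<phi> a \<preceq> \<phi> (gr_abs b))"

lemma positive_map_seminorm:
  assumes \<phi>: "positive_map \<phi>" and f: "unconditional_seminorm f"
  shows "unconditional_seminorm (\<lambda>a. f (\<phi> (gr_abs a)))"
proof -
  note f = unconditional_seminormD[OF f]
  have add: "\<And>a b. \<phi> (a + b) = \<phi> a + \<phi> b" and scale: "\<And>c a. \<phi> (gr_scale c a) = gr_scale c (\<phi> a)"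
    and mono: "\<And>a b. a \<preceq> b \<Longrightarrow> f (\<phi> a) \<le> f (\<phi> (gr_abs b))"
    using \<phi> f(3) unfolding positive_map_def by blast+
  show ?thesis unfolding unconditional_seminorm_def is_seminorm_def
  proof (intro conjI allI impI)
    fix a b :: "'a group_ring"
    have "gr_abs (a + b) \<preceq> gr_abs a + gr_abs b"
      using norm_triangle_ineq[of "Poly_Mapping.lookup a _" "Poly_Mapping.lookup b _"]
      by (simp add: lookup_add flip: of_real_add)
    from mono[OF this] show "f (\<phi> (gr_abs (a + b))) \<le> f (\<phi> (gr_abs a)) + f (\<phi> (gr_abs b))"
      using f(1)[of "\<phi> (gr_abs a)" "\<phi> (gr_abs b)"] by (simp add: gr_abs_add_fixed add)
  next
    fix c and a :: "'a group_ring"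
    show "f (\<phi> (gr_abs (gr_scale c a))) = cmod c * f (\<phi> (gr_abs a))"
      by (simp add: gr_abs_scale scale f(2))
  next
    fix a b :: "'a group_ring" assume "a \<preceq> b"
    then have "gr_abs a \<preceq> b" by simp
    from mono[OF this] show "f (\<phi> (gr_abs a)) \<le> f (\<phi> (gr_abs b))" .
  qed
qed

lemma positive_map_mult_left: "positive_map (\<lambda>b. gr_abs w * b)"
  for w :: "'g::group_add group_ring"
proof -
  have "gr_abs w * a \<preceq> gr_abs w * gr_abs b" if "a \<preceq> b" for a b
    using mult_dominated[of "gr_abs w" w a b] that by simp
  then show ?thesis by (simp add: positive_map_def distrib_left gr_scale_mult_right)
qed

lemma positive_map_mult_right: "positive_map (\<lambda>a. a * gr_abs w)"
  for w :: "'g::group_add group_ring"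
proof -
  have "a * gr_abs w \<preceq> gr_abs b * gr_abs w" if "a \<preceq> b" for a b
    using mult_dominated[of a b "gr_abs w" w] that by simp
  then show ?thesis by (simp add: positive_map_def distrib_right gr_scale_mult_left)
qed

lemma lookup_char_map:
  assumes "finite K" "Poly_Mapping.keys a \<subseteq> K"
  shows "Poly_Mapping.lookup (char_map h a) x = (\<Sum>g\<in>K. if h (conj_class g) = x then Poly_Mapping.lookup a g else 0)"
proof -
  have "Poly_Mapping.lookup (char_map h a) x =
      (\<Sum>g\<in>Poly_Mapping.keys a. if h (conj_class g) = x then Poly_Mapping.lookup a g else 0)"
    by (simp add: char_map_def lookup_sum lookup_single when_def)
  also have "\<dots> = (\<Sum>g\<in>K. if h (conj_class g) = x then Poly_Mapping.lookup a g else 0)"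
    using assms by (intro sum.mono_neutral_left) (auto simp: in_keys_iff)
  finally show ?thesis .
qed

lemma char_map_add: "char_map h (a + b) = char_map h a + char_map h b"
proof (rule poly_mapping_eqI)
  fix x
  let ?K = "Poly_Mapping.keys a \<union> Poly_Mapping.keys b"
  have "Poly_Mapping.keys (a + b) \<subseteq> ?K" by (rule keys_add)
  then show "Poly_Mapping.lookup (char_map h (a + b)) x = Poly_Mapping.lookup (char_map h a + char_map h b) x"
    by (simp add: lookup_char_map[where K="?K"] lookup_add flip: sum.distrib) (rule sum.cong, auto simp: lookup_add)
qed

lemma char_map_scale: "char_map h (gr_scale c a) = gr_scale c (char_map h a)"
proof (rule poly_mapping_eqI)
  fix x
  have "Poly_Mapping.keys (gr_scale c a) \<subseteq> Poly_Mapping.keys a" by (auto simp: in_keys_iff)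
  then show "Poly_Mapping.lookup (char_map h (gr_scale c a)) x = Poly_Mapping.lookup (gr_scale c (char_map h a)) x"
    by (simp add: lookup_char_map[where K="Poly_Mapping.keys a"] sum_distrib_left if_distrib cong: if_cong)
qed

lemma positive_map_char_map: "positive_map (char_map h)"
  unfolding positive_map_def
proof (intro conjI allI impI)
  fix a b :: "'a group_ring" and x assume ab: "a \<preceq> b"
  let ?K = "Poly_Mapping.keys b"
  have "Poly_Mapping.keys a \<subseteq> ?K"
  proof
    fix y assume "y \<in> Poly_Mapping.keys a"
    then show "y \<in> ?K" using ab by (metis in_keys_iff norm_le_zero_iff norm_zero)
  qed
  then have "cmod (Poly_Mapping.lookup (char_map h a) x) =
      cmod (\<Sum>g\<in>?K. if h (conj_class g) = x then Poly_Mapping.lookup a g else 0)"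
    by (simp add: lookup_char_map[where K="?K"])
  also have "\<dots> \<le> (\<Sum>g\<in>?K. if h (conj_class g) = x then cmod (Poly_Mapping.lookup b g) else 0)"
    using ab by (intro sum_norm_le) simp
  also have "\<dots> = cmod (complex_of_real (\<Sum>g\<in>?K. if h (conj_class g) = x then cmod (Poly_Mapping.lookup b g) else 0))"
    by (subst norm_of_real) (simp add: sum_nonneg)
  also have "\<dots> = cmod (Poly_Mapping.lookup (char_map h (gr_abs b)) x)"
    by (simp add: lookup_char_map[where K="?K"] if_distrib cong: if_cong)
  finally show "cmod (Poly_Mapping.lookup (char_map h a) x) \<le> \<dots>" .
qed (simp_all add: char_map_add char_map_scale)

section \<open>The largest unconditional submultiplicative seminorm\<close>

text \<open>
  Membership in this set can be verified for seminorms such as \<open>a \<mapsto> p (\<phi> |a|)\<close> with a positive map \<open>\<phi>\<close>,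
  which are rarely submultiplicative. The supremum of the set is submultiplicative all the same, by
  \<open>largest_seminorm_submultiplicative\<close>.
\<close>

definition product_bounded :: "'g::group_add group_ring set \<Rightarrow> ('g group_ring \<Rightarrow> real) set" where
  "product_bounded T = {f. unconditional_seminorm f \<and>
     (\<forall>ts. ts \<noteq> [] \<and> set ts \<subseteq> T \<longrightarrow> f (prod_list (map gr_abs ts)) \<le> 1)}"

definition largest_seminorm :: "'g::group_add group_ring set \<Rightarrow> 'g group_ring \<Rightarrow> real" where
  "largest_seminorm T a = (SUP f\<in>product_bounded T. f a)"

definition submultiplicative_class :: "'g::group_add group_ring set \<Rightarrow> ('g group_ring \<Rightarrow> real) set" where
  "submultiplicative_class T = {p. unconditional_seminorm p \<and> (\<forall>a b. p (a * b) \<le> p a * p b) \<and> (\<forall>t\<in>T. p t \<le> 1)}"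

lemma gr_abs_prod_list_fixed:
  "ts \<noteq> [] \<Longrightarrow> gr_abs (prod_list (map gr_abs ts)) = prod_list (map gr_abs ts)"
  for ts :: "'g::group_add group_ring list"
proof (induction ts)
  case (Cons t ts)
  show ?case
  proof (cases "ts = []")
    case False
    then have "gr_abs t * prod_list (map gr_abs ts) = gr_abs t * gr_abs (prod_list (map gr_abs ts))"
      using Cons by simp
    then show ?thesis by (simp add: gr_abs_mult_fixed)
  qed simp
qed simp

lemma submultiplicative_prod_list:
  assumes "unconditional_seminorm p" "\<And>a b. p (a * b) \<le> p a * p b" "ts \<noteq> []" "\<And>t. t \<in> set ts \<Longrightarrow> p t \<le> r"
  shows "p (prod_list (map gr_abs ts)) \<le> r ^ length ts"
  using assms(3,4)
proof (induction ts)
  case (Cons t ts)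
  note p = unconditional_seminormD[OF assms(1)]
  have t: "p t \<le> r" using Cons.prems by simp
  show ?case
  proof (cases "ts = []")
    case True then show ?thesis using t p(6)[of t] by simp
  next
    case False
    have "p (gr_abs t * prod_list (map gr_abs ts)) \<le> p t * p (prod_list (map gr_abs ts))"
      using assms(2)[of "gr_abs t"] p(6)[of t] by simp
    also have "\<dots> \<le> r * r ^ length ts"
      using t Cons False p(5) order_trans[OF p(5) t] by (intro mult_mono) auto
    finally show ?thesis by simp
  qed
qed simp

lemma submultiplicative_class_subset: "submultiplicative_class T \<subseteq> product_bounded T"
proof
  fix p assume p: "p \<in> submultiplicative_class T"
  then have "p (prod_list (map gr_abs ts)) \<le> 1" if "ts \<noteq> []" "set ts \<subseteq> T" for ts
    using submultiplicative_prod_list[of p ts 1] that by (auto simp: submultiplicative_class_def)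
  then show "p \<in> product_bounded T" using p by (auto simp: product_bounded_def submultiplicative_class_def)
qed

lemma unconditional_seminorm_times:
  assumes "unconditional_seminorm f" "0 \<le> k"
  shows "unconditional_seminorm (\<lambda>a. k * f a)"
proof -
  note f = unconditional_seminormD[OF assms(1)]
  show ?thesis unfolding unconditional_seminorm_def is_seminorm_def
  proof (intro conjI allI impI)
    show "k * f (a + b) \<le> k * f a + k * f b" for a b
      using mult_left_mono[OF f(1) assms(2), of a b] by (simp add: distrib_left)
    show "k * f (gr_scale c a) = cmod c * (k * f a)" for c a by (simp add: f(2))
    show "k * f a \<le> k * f b" if "a \<preceq> b" for a b by (rule mult_left_mono[OF f(3)[OF that] assms(2)])
  qed
qed

text \<open>
  This condition makes the supremum over \<open>product_bounded T\<close> finite: it bounds each of these seminorms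
  on the basis elements by a constant that depends on the basis element only.
\<close>

definition spanning_products :: "'g::group_add group_ring set \<Rightarrow> bool" where
  "spanning_products T \<longleftrightarrow> (\<forall>g. \<exists>ts c. ts \<noteq> [] \<and> set ts \<subseteq> T \<and> 0 < c \<and>
      prod_list (map gr_abs ts) = Poly_Mapping.single g (complex_of_real c))"

lemma product_bounded_bdd_above:
  assumes "spanning_products T"
  shows "bdd_above ((\<lambda>f. f a) ` product_bounded T)"
proof -
  have "\<exists>M. \<forall>f\<in>product_bounded T. f (gr_basis g) \<le> M" for g
  proof -
    obtain ts c where ts: "ts \<noteq> []" "set ts \<subseteq> T" "0 < c"
      "prod_list (map gr_abs ts) = Poly_Mapping.single g (complex_of_real c)"
      using assms unfolding spanning_products_def by meson
    have "f (gr_basis g) \<le> 1 / c" if "f \<in> product_bounded T" for f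
    proof -
      have "gr_scale (complex_of_real c) (gr_basis g) = Poly_Mapping.single g (complex_of_real c)"
        by (rule poly_mapping_eqI) (simp add: lookup_single when_def)
      then have "c * f (gr_basis g) \<le> 1"
        using that ts unconditional_seminormD(2)[of f "complex_of_real c" "gr_basis g"]
        by (auto simp: product_bounded_def)
      then show ?thesis using ts(3) by (simp add: field_simps)
    qed
    then show ?thesis by blast
  qed
  then obtain M where M: "\<And>g f. f \<in> product_bounded T \<Longrightarrow> f (gr_basis g) \<le> M g" by metis
  have "f a \<le> (\<Sum>g\<in>Poly_Mapping.keys a. cmod (Poly_Mapping.lookup a g) * M g)" if f: "f \<in> product_bounded T" for f
  proof -
    have u: "unconditional_seminorm f" using f by (simp add: product_bounded_def)
    have "gr_scale c (gr_basis g) = Poly_Mapping.single g c" for c and g :: 'a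
      by (rule poly_mapping_eqI) (simp add: lookup_single when_def)
    then have single: "f (Poly_Mapping.single g c) = cmod c * f (gr_basis g)" for g c
      using unconditional_seminormD(2)[OF u] by metis
    have "f a = f (\<Sum>g\<in>Poly_Mapping.keys a. Poly_Mapping.single g (Poly_Mapping.lookup a g))"
      by (simp add: sum_of_singles)
    also have "\<dots> \<le> (\<Sum>g\<in>Poly_Mapping.keys a. f (Poly_Mapping.single g (Poly_Mapping.lookup a g)))"
      by (rule unconditional_seminorm_sum[OF u])
    also have "\<dots> \<le> (\<Sum>g\<in>Poly_Mapping.keys a. cmod (Poly_Mapping.lookup a g) * M g)"
      by (intro sum_mono, subst single) (intro mult_left_mono M[OF f], simp)
    finally show ?thesis .
  qed
  then show ?thesis by (rule bdd_aboveI2)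
qed

lemma le_largest_seminorm:
  assumes "spanning_products T" "f \<in> product_bounded T"
  shows "f a \<le> largest_seminorm T a"
  unfolding largest_seminorm_def by (rule cSUP_upper[OF assms(2) product_bounded_bdd_above[OF assms(1)]])

lemma zero_in_product_bounded: "(\<lambda>_. 0) \<in> product_bounded T"
  by (simp add: product_bounded_def unconditional_seminorm_def is_seminorm_def)

lemma largest_seminorm_le:
  assumes "\<And>f. f \<in> product_bounded T \<Longrightarrow> f a \<le> r"
  shows "largest_seminorm T a \<le> r"
  unfolding largest_seminorm_def using zero_in_product_bounded[of T] assms by (intro cSUP_least) auto

lemma largest_seminorm_unconditional:
  assumes "spanning_products T"
  shows "unconditional_seminorm (largest_seminorm T)"
proof -
  let ?N = "largest_seminorm T"
  note le = le_largest_seminorm[OF assms]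
  have F: "unconditional_seminorm f" if "f \<in> product_bounded T" for f using that by (simp add: product_bounded_def)
  have scale: "?N (gr_scale c a) \<le> cmod c * ?N a" for c a
  proof (rule largest_seminorm_le)
    fix f assume f: "f \<in> product_bounded T"
    show "f (gr_scale c a) \<le> cmod c * ?N a"
      using unconditional_seminormD(2)[OF F[OF f]] le[OF f] by (simp add: mult_left_mono)
  qed
  show ?thesis unfolding unconditional_seminorm_def is_seminorm_def
  proof (intro conjI allI impI)
    fix a b
    show "?N (a + b) \<le> ?N a + ?N b"
    proof (rule largest_seminorm_le)
      fix f assume f: "f \<in> product_bounded T"
      show "f (a + b) \<le> ?N a + ?N b"
        using unconditional_seminormD(1)[OF F[OF f], of a b] le[OF f, of a] le[OF f, of b] by linarith
    qed
  next
    fix c a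
    show "?N (gr_scale c a) = cmod c * ?N a"
    proof (cases "c = 0")
      case True
      then show ?thesis using scale[of 0 a] le[OF zero_in_product_bounded, of "gr_scale 0 a"] by simp
    next
      case False
      have "gr_scale (inverse c) (gr_scale c a) = a" by (rule poly_mapping_eqI) (simp add: False)
      then have "cmod c * ?N a \<le> cmod c * (cmod (inverse c) * ?N (gr_scale c a))"
        using scale[of "inverse c" "gr_scale c a"] by (simp add: mult_left_mono)
      also have "\<dots> = ?N (gr_scale c a)" using False by (simp add: norm_inverse)
      finally show ?thesis using scale[of c a] by simp
    qed
  next
    fix a b :: "'a group_ring" assume "a \<preceq> b"
    show "?N a \<le> ?N b"
    proof (rule largest_seminorm_le)
      fix f assume f: "f \<in> product_bounded T"
      show "f a \<le> ?N b"
        using unconditional_seminormD(3)[OF F[OF f] \<open>a \<preceq> b\<close>] le[OF f, of b] by linarith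
    qed
  qed
qed

text \<open>
  Fix \<open>f \<in> product_bounded T\<close>. For a product \<open>w\<close> of elements \<open>|t|\<close>, the seminorm
  \<open>b \<mapsto> f (w * |b|)\<close> is again in \<open>product_bounded T\<close>, because products of products are products; so
  \<open>f (w * |b|) \<le> N b\<close>, where \<open>N\<close> is the largest seminorm. For fixed \<open>b\<close>, therefore, \<open>a \<mapsto> f (|a| * |b|) / N b\<close> is in
  \<open>product_bounded T\<close> as well, and \<open>f (|a| * |b|) \<le> N a * N b\<close>.
\<close>

lemma largest_seminorm_submultiplicative:
  assumes T: "spanning_products T"
  shows "largest_seminorm T (a * b) \<le> largest_seminorm T a * largest_seminorm T b"
proof (rule largest_seminorm_le)
  let ?N = "largest_seminorm T"
  note N = unconditional_seminormD[OF largest_seminorm_unconditional[OF T]]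
  fix f assume f: "f \<in> product_bounded T"
  then have u: "unconditional_seminorm f" by (simp add: product_bounded_def)
  have 1: "f (prod_list (map gr_abs ts) * gr_abs b) \<le> ?N b" if ts: "ts \<noteq> []" "set ts \<subseteq> T" for ts
  proof -
    let ?w = "prod_list (map gr_abs ts)"
    have "f (?w * gr_abs (prod_list (map gr_abs us))) \<le> 1" if "us \<noteq> []" "set us \<subseteq> T" for us
      using f ts that gr_abs_prod_list_fixed[of us] unfolding product_bounded_def
      by (auto dest!: spec[of _ "ts @ us"])
    moreover have "unconditional_seminorm (\<lambda>b. f (?w * gr_abs b))"
      using positive_map_seminorm[OF positive_map_mult_left u, of ?w] gr_abs_prod_list_fixed[OF ts(1)] by simp
    ultimately have "(\<lambda>b. f (?w * gr_abs b)) \<in> product_bounded T" by (simp add: product_bounded_def)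
    from le_largest_seminorm[OF T this] show ?thesis .
  qed
  define F where "F a = f (gr_abs a * gr_abs b)" for a
  have F: "unconditional_seminorm F"
    unfolding F_def by (rule positive_map_seminorm[OF positive_map_mult_right u])
  have F1: "F (prod_list (map gr_abs ts)) \<le> ?N b" if "ts \<noteq> []" "set ts \<subseteq> T" for ts
    using 1[OF that] gr_abs_prod_list_fixed[OF that(1)] by (simp add: F_def)
  \<comment> \<open>Division by \<open>?N b\<close> is phrased with a factor \<open>k\<close> to cover \<open>?N b = 0\<close>, where \<open>k\<close> may be arbitrarily large.\<close>
  have scaled: "k * F a \<le> ?N a" if "0 \<le> k" "k * ?N b \<le> 1" for k
  proof -
    have "k * F (prod_list (map gr_abs ts)) \<le> 1" if "ts \<noteq> []" "set ts \<subseteq> T" for ts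
      using mult_left_mono[OF F1[OF that] \<open>0 \<le> k\<close>] \<open>k * ?N b \<le> 1\<close> by linarith
    then have "(\<lambda>a. k * F a) \<in> product_bounded T"
      using unconditional_seminorm_times[OF F \<open>0 \<le> k\<close>] by (simp add: product_bounded_def)
    from le_largest_seminorm[OF T this] show ?thesis .
  qed
  have "F a \<le> ?N a * ?N b"
  proof (cases "?N b = 0")
    case False
    then have "0 < ?N b" using N(5)[of b] by simp
    then show ?thesis using scaled[of "1 / ?N b"] by (simp add: field_simps)
  next
    case True
    have "F a \<le> 0"
    proof (rule ccontr)
      assume *: "\<not> F a \<le> 0"
      have "?N a + 1 = (?N a + 1) / F a * F a" using * by simp
      also have "\<dots> \<le> ?N a" using * True N(5)[of a] by (intro scaled) auto
      finally show False by simp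
    qed
    then show ?thesis using True by simp
  qed
  moreover have "f (a * b) \<le> F a"
    unfolding F_def by (rule unconditional_seminormD(3)[OF u]) (rule mult_dominated, simp_all)
  ultimately show "f (a * b) \<le> ?N a * ?N b" by linarith
qed

lemma largest_seminorm_in_class:
  assumes T: "spanning_products T"
  shows "largest_seminorm T \<in> submultiplicative_class T"
proof -
  have "largest_seminorm T t \<le> 1" if "t \<in> T" for t
  proof (rule largest_seminorm_le)
    fix f assume f: "f \<in> product_bounded T"
    then have u: "unconditional_seminorm f"
      and "[t] \<noteq> [] \<and> set [t] \<subseteq> T \<longrightarrow> f (prod_list (map gr_abs [t])) \<le> 1"
      unfolding product_bounded_def by blast+
    then show "f t \<le> 1" using that unconditional_seminormD(6)[OF u, of t] by simp
  qed
  then show ?thesis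
    using largest_seminorm_unconditional[OF T] largest_seminorm_submultiplicative[OF T]
    by (simp add: submultiplicative_class_def)
qed

lemma Greatest_submultiplicative_class:
  assumes T: "spanning_products T"
  shows "(GREATEST p. unconditional_seminorm p \<and> (\<forall>a b. p (a * b) \<le> p a * p b) \<and> (\<forall>t\<in>T. p t \<le> 1)) = largest_seminorm T"
proof (rule Greatest_equality)
  show "unconditional_seminorm (largest_seminorm T) \<and>
      (\<forall>a b. largest_seminorm T (a * b) \<le> largest_seminorm T a * largest_seminorm T b) \<and>
      (\<forall>t\<in>T. largest_seminorm T t \<le> 1)"
    using largest_seminorm_in_class[OF T] by (simp add: submultiplicative_class_def)
next
  fix p assume "unconditional_seminorm p \<and> (\<forall>a b. p (a * b) \<le> p a * p b) \<and> (\<forall>t\<in>T. p t \<le> 1)"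
  then have "p \<in> product_bounded T"
    using submultiplicative_class_subset[of T] by (auto simp: submultiplicative_class_def)
  from le_largest_seminorm[OF T this] show "p \<le> largest_seminorm T" by (simp add: le_fun_def)
qed

section \<open>The sets T and their seminorms\<close>

lemma gr_scale_single: "gr_scale c (Poly_Mapping.single g z) = Poly_Mapping.single g (c * z)"
  by (rule poly_mapping_eqI) (simp add: lookup_single when_def)

lemma frechet_algebraD:
  assumes "frechet_algebra sc Q"
  shows "vector_space sc" "is_seminorm sc (Q i)"
    "open V \<longleftrightarrow> (\<forall>x\<in>V. \<exists>k. \<exists>e>0. {y. \<forall>i\<le>k. Q i (y - x) < e} \<subseteq> V)"
proof -
  show "vector_space sc"
    using assms unfolding frechet_algebra_def by (elim conjE)
  show "is_seminorm sc (Q i)"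
    using assms unfolding frechet_algebra_def by (elim conjE) (erule spec)
  show "open V \<longleftrightarrow> (\<forall>x\<in>V. \<exists>k. \<exists>e>0. {y. \<forall>i\<le>k. Q i (y - x) < e} \<subseteq> V)"
    using assms unfolding frechet_algebra_def by (elim conjE) (erule spec)
qed

lemma unconditional_frechet_algebraD:
  assumes "unconditional_frechet_algebra sc \<iota>"
  shows "\<iota> (gr_scale c a) = sc c (\<iota> a)" "\<exists>Q. frechet_algebra sc Q" "vector_space sc"
proof -
  show "\<iota> (gr_scale c a) = sc c (\<iota> a)"
    using assms unfolding unconditional_frechet_algebra_def by (elim conjE) simp
  show "\<exists>Q. frechet_algebra sc Q"
    using assms unfolding unconditional_frechet_algebra_def by (elim conjE exE) (rule exI)
  then show "vector_space sc" using frechet_algebraD(1) by blast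
qed

lemma open_absorbs:
  assumes "frechet_algebra sc Q" "open U" "0 \<in> U"
  shows "\<exists>c>0. sc (complex_of_real c) x \<in> U"
proof -
  have Q: "Q i (sc c x) = cmod c * Q i x" for i c
    using frechet_algebraD(2)[OF assms(1), of i] unfolding is_seminorm_def by simp
  have "open U \<longleftrightarrow> (\<forall>x\<in>U. \<exists>k. \<exists>e>0. {y. \<forall>i\<le>k. Q i (y - x) < e} \<subseteq> U)"
    by (rule frechet_algebraD(3)[OF assms(1)])
  then obtain k e where e: "e > 0" "{y. \<forall>i\<le>k. Q i (y - 0) < e} \<subseteq> U"
    using assms(2,3) by blast
  define M where "M = (\<Sum>i\<le>k. \<bar>Q i x\<bar>) + 1"
  have M: "\<bar>Q i x\<bar> < M" if "i \<le> k" for i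
    using member_le_sum[of i "{..k}" "\<lambda>i. \<bar>Q i x\<bar>"] that by (simp add: M_def)
  have M0: "M > 0" using M[of 0] by simp
  have "Q i (sc (complex_of_real (e / M)) x) < e" if "i \<le> k" for i
  proof -
    have "Q i (sc (complex_of_real (e / M)) x) = e / M * Q i x"
      using e(1) M0 by (simp add: Q del: of_real_divide)
    also have "\<dots> < e / M * M" using M[OF that] e(1) M0 by (intro mult_strict_left_mono) auto
    finally show ?thesis using M0 by simp
  qed
  then show ?thesis using e M0 by (intro exI[of _ "e / M"]) auto
qed

text \<open>
  Small multiples of the generators and of the identity lie in the neighbourhood \<open>U\<close> of \<open>0\<close>. The identity
  is needed to write \<open>u_0\<close> as a nonempty product.
\<close>

lemma T_set_spanning:
  fixes sc :: "complex \<Rightarrow> 'a::{ring_1,t2_space} \<Rightarrow> 'a" and \<iota> :: "'g::group_add group_ring \<Rightarrow> 'a"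
  assumes alg: "unconditional_frechet_algebra sc \<iota>" and gen: "symmetric_generating_set S"
    and U: "open U" "0 \<in> U" and n: "1 \<le> n"
  shows "spanning_products (T_set sc \<iota> S U n)"
proof -
  obtain Q where Q: "frechet_algebra sc Q"
    using unconditional_frechet_algebraD(2)[OF alg] by blast
  interpret vector_space sc by (rule unconditional_frechet_algebraD(3)[OF alg])
  note \<iota> = unconditional_frechet_algebraD(1)[OF alg]
  have small: "\<exists>c>0. Poly_Mapping.single g (complex_of_real c) \<in> T_set sc \<iota> S U n"
    if g: "word_length S g \<le> 1" for g
  proof -
    define r where "r = (of_nat n / of_nat (n + 1) :: complex)"
    obtain c where c: "c > 0" "sc (complex_of_real c) (\<iota> (gr_basis g)) \<in> U"
      using open_absorbs[OF Q U] by blast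
    define c' where "c' = real n / real (n + 1) * c"
    have "complex_of_real c' = r * complex_of_real c" by (simp add: c'_def r_def)
    then have "\<iota> (Poly_Mapping.single g (complex_of_real c')) = sc r (sc (complex_of_real c) (\<iota> (gr_basis g)))"
      by (simp add: scale_scale flip: \<iota>) (simp add: gr_scale_single)
    then have "\<iota> (Poly_Mapping.single g (complex_of_real c')) \<in> sc r ` U" using c(2) by blast
    moreover have "c' > 0" using n c(1) by (simp add: c'_def)
    ultimately show ?thesis
      using g n by (intro exI[of _ c']) (auto simp: T_set_def r_def split: if_splits)
  qed
  have "\<exists>ts c. ts \<noteq> [] \<and> set ts \<subseteq> T_set sc \<iota> S U n \<and> 0 < c \<and>
      prod_list (map gr_abs ts) = Poly_Mapping.single (sum_list w) (complex_of_real c)" if "w \<in> lists S" for w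
    using that
  proof (induction w)
    case Nil
    obtain c where "c > 0" "Poly_Mapping.single 0 (complex_of_real c) \<in> T_set sc \<iota> S U n"
      using small[of 0] by auto
    then show ?case by (intro exI[of _ "[Poly_Mapping.single 0 (complex_of_real c)]"] exI[of _ c]) simp
  next
    case (Cons s w)
    then obtain ts c where ts: "ts \<noteq> []" "set ts \<subseteq> T_set sc \<iota> S U n" "0 < c"
      "prod_list (map gr_abs ts) = Poly_Mapping.single (sum_list w) (complex_of_real c)" by blast
    have "word_length S s \<le> 1" using word_length_sum_list_le[of "[s]" S] Cons.hyps by simp
    then obtain c' where "c' > 0" "Poly_Mapping.single s (complex_of_real c') \<in> T_set sc \<iota> S U n"
      using small by blast
    with ts show ?case
      by (intro exI[of _ "Poly_Mapping.single s (complex_of_real c') # ts"] exI[of _ "c' * c"])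
        (simp add: mult_single)
  qed
  moreover have "\<exists>w\<in>lists S. sum_list w = g" for g
    using gen unfolding symmetric_generating_set_def by blast
  ultimately show ?thesis unfolding spanning_products_def by metis
qed

text \<open>
  Passing from \<open>n\<close> to \<open>m\<close> replaces the factor \<open>n / (n + 1)\<close> of \<open>U\<close> by \<open>m / (m + 1)\<close>; the quotient of the two
  is less than \<open>1\<close> for \<open>n < m\<close>, and this is the source of the geometric decay \<open>\<rho>^k\<close>.
\<close>

lemma T_set_shrink:
  fixes sc :: "complex \<Rightarrow> 'a::{ring_1,t2_space} \<Rightarrow> 'a" and \<iota> :: "'g::group_add group_ring \<Rightarrow> 'a"
  assumes alg: "unconditional_frechet_algebra sc \<iota>" and nm: "1 \<le> n" "n \<le> m" and t: "t \<in> T_set sc \<iota> S U n"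
    and p: "unconditional_seminorm p" "\<And>t. t \<in> T_set sc \<iota> S U m \<Longrightarrow> p t \<le> 1"
  shows "p t \<le> (real n / real (n + 1)) / (real m / real (m + 1))"
proof -
  interpret vector_space sc by (rule unconditional_frechet_algebraD(3)[OF alg])
  note \<iota> = unconditional_frechet_algebraD(1)[OF alg]
  define r s where "r = real n / real (n + 1)" and "s = real m / real (m + 1)"
  have s_eq: "of_nat m / of_nat (m + 1) = complex_of_real s" by (simp add: s_def)
  have pos: "r > 0" "s > 0" using nm by (simp_all add: r_def s_def)
  obtain u where u: "u \<in> U" "\<iota> t = sc (complex_of_real r) u"
    using t unfolding T_set_def r_def by auto
  have "\<iota> (gr_scale (complex_of_real (s / r)) t) = sc (complex_of_real s) u"
    using pos by (simp add: \<iota> u(2))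
  then have "\<iota> (gr_scale (complex_of_real (s / r)) t) \<in> sc (of_nat m / of_nat (m + 1)) ` U"
    unfolding s_eq by (metis imageI u(1))
  moreover have "word_length S g \<le> m" if "g \<in> Poly_Mapping.keys (gr_scale (complex_of_real (s / r)) t)" for g
  proof -
    have "g \<in> Poly_Mapping.keys t" using that by (simp add: in_keys_iff)
    then show ?thesis using t nm unfolding T_set_def by fastforce
  qed
  ultimately have "p (gr_scale (complex_of_real (s / r)) t) \<le> 1"
    by (intro p(2)) (simp add: T_set_def)
  moreover have "p (gr_scale (complex_of_real (s / r)) t) = (s / r) * p t"
    using pos by (simp add: unconditional_seminormD(2)[OF p(1)] del: of_real_divide)
  ultimately have "(s / r) * p t \<le> 1" by (simp only:)
  then show ?thesis using pos unfolding r_def[symmetric] s_def[symmetric] by (simp add: field_simps)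
qed

lemma A_seminorm_eq:
  fixes sc :: "complex \<Rightarrow> 'a::{ring_1,t2_space} \<Rightarrow> 'a" and \<iota> :: "'g::group_add group_ring \<Rightarrow> 'a"
  assumes "unconditional_frechet_algebra sc \<iota>" "symmetric_generating_set S" "open U" "0 \<in> U" "1 \<le> n"
  shows "A_seminorm sc \<iota> S U n = largest_seminorm (T_set sc \<iota> S U n)"
  unfolding A_seminorm_def by (rule Greatest_submultiplicative_class[OF T_set_spanning[OF assms]])

lemma A_seminorm_unconditional:
  fixes sc :: "complex \<Rightarrow> 'a::{ring_1,t2_space} \<Rightarrow> 'a" and \<iota> :: "'g::group_add group_ring \<Rightarrow> 'a"
  assumes "unconditional_frechet_algebra sc \<iota>" "symmetric_generating_set S" "open U" "0 \<in> U" "1 \<le> n"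
  shows "unconditional_seminorm (A_seminorm sc \<iota> S U n)"
  unfolding A_seminorm_eq[OF assms] by (rule largest_seminorm_unconditional[OF T_set_spanning[OF assms]])

lemma A_seminorm_antimono:
  fixes sc :: "complex \<Rightarrow> 'a::{ring_1,t2_space} \<Rightarrow> 'a" and \<iota> :: "'g::group_add group_ring \<Rightarrow> 'a"
  assumes alg: "unconditional_frechet_algebra sc \<iota>" and S: "symmetric_generating_set S"
    and U: "open U" "0 \<in> U" and nm: "1 \<le> n" "n \<le> m"
  shows "A_seminorm sc \<iota> S U m a \<le> A_seminorm sc \<iota> S U n a"
proof -
  let ?p = "largest_seminorm (T_set sc \<iota> S U m)"
  have m: "1 \<le> m" using nm by simp
  have p: "?p \<in> submultiplicative_class (T_set sc \<iota> S U m)"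
    by (rule largest_seminorm_in_class[OF T_set_spanning[OF alg S U m]])
  have "?p t \<le> 1" if "t \<in> T_set sc \<iota> S U n" for t
  proof -
    have "?p t \<le> (real n / real (n + 1)) / (real m / real (m + 1))"
      using p by (intro T_set_shrink[OF alg nm that]) (auto simp: submultiplicative_class_def)
    also have "\<dots> \<le> 1"
    proof -
      have "0 < real m / real (m + 1)" "real n / real (n + 1) \<le> real m / real (m + 1)"
        using nm by (simp_all add: field_simps)
      then show ?thesis by (simp only: divide_le_eq_1_pos)
    qed
    finally show ?thesis .
  qed
  then have "?p \<in> submultiplicative_class (T_set sc \<iota> S U n)"
    using p by (simp add: submultiplicative_class_def)
  then have "?p \<in> product_bounded (T_set sc \<iota> S U n)" using submultiplicative_class_subset by blast
  from le_largest_seminorm[OF T_set_spanning[OF alg S U nm(1)] this] show ?thesis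
    unfolding A_seminorm_eq[OF alg S U nm(1)] A_seminorm_eq[OF alg S U m] .
qed

section \<open>The characteristic map on products\<close>

definition weight :: "'g group_ring list \<Rightarrow> 'g list \<Rightarrow> real" where
  "weight ts gs = prod_list (map2 (\<lambda>t g. cmod (Poly_Mapping.lookup t g)) ts gs)"

lemma weight_nonneg: "0 \<le> weight ts gs"
  unfolding weight_def by (induction ts arbitrary: gs) (auto simp: zip_Cons1 split: list.split)

lemma weight_rotate1:
  assumes "length ts = length gs"
  shows "weight (rotate1 ts) (rotate1 gs) = weight ts gs"
  using assms by (cases ts; cases gs) (simp_all add: weight_def mult.commute)

lemma weight_rotate:
  assumes "length ts = length gs"
  shows "weight (rotate i ts) (rotate i gs) = weight ts gs"
  using assms by (induction i) (simp_all add: weight_rotate1)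

lemma prod_list_expansion:
  fixes ts :: "'g::group_add group_ring list"
  assumes K: "finite K" and ts: "\<And>t. t \<in> set ts \<Longrightarrow> Poly_Mapping.keys t \<subseteq> K"
  shows "prod_list (map gr_abs ts) = (\<Sum>gs | set gs \<subseteq> K \<and> length gs = length ts.
            Poly_Mapping.single (sum_list gs) (complex_of_real (weight ts gs)))"
  using ts
proof (induction ts)
  case Nil
  have "{gs. set gs \<subseteq> K \<and> length gs = length []} = {[]}" by auto
  then show ?case by (simp add: weight_def)
next
  case (Cons t ts)
  let ?L = "{gs. set gs \<subseteq> K \<and> length gs = length ts}"
  have "{gs. set gs \<subseteq> K \<and> length gs = length (t # ts)} = (\<lambda>(g, gs). g # gs) ` (K \<times> ?L)"
    by (auto simp: image_iff length_Suc_conv)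
  moreover have "inj_on (\<lambda>(g, gs). g # gs) (K \<times> ?L)" by (auto simp: inj_on_def)
  ultimately have "(\<Sum>gs | set gs \<subseteq> K \<and> length gs = length (t # ts).
            Poly_Mapping.single (sum_list gs) (complex_of_real (weight (t # ts) gs))) =
     (\<Sum>(g, gs)\<in>K \<times> ?L. Poly_Mapping.single (g + sum_list gs) (complex_of_real (cmod (Poly_Mapping.lookup t g) * weight ts gs)))"
    by (simp add: sum.reindex weight_def case_prod_unfold)
  also have "\<dots> = (\<Sum>g\<in>K. \<Sum>gs\<in>?L. Poly_Mapping.single g (Poly_Mapping.lookup (gr_abs t) g) *
       Poly_Mapping.single (sum_list gs) (complex_of_real (weight ts gs)))"
    by (simp add: sum.cartesian_product mult_single)
  also have "\<dots> = (\<Sum>g\<in>K. Poly_Mapping.single g (Poly_Mapping.lookup (gr_abs t) g)) * prod_list (map gr_abs ts)"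
    using Cons by (simp add: sum_product)
  also have "(\<Sum>g\<in>K. Poly_Mapping.single g (Poly_Mapping.lookup (gr_abs t) g)) = gr_abs t"
    using Cons.prems by (intro sum_of_singles K) simp
  finally show ?case by simp
qed

lemma bij_betw_rotate:
  assumes "finite K"
  shows "bij_betw (rotate i) {gs. set gs \<subseteq> K \<and> length gs = k} {gs. set gs \<subseteq> K \<and> length gs = k}"
proof (rule bij_betwI')
  fix xs ys :: "'a list"
  show "(rotate i xs = rotate i ys) = (xs = ys)"
    unfolding rotate_def using inj_rotate1 inj_fn by (metis injD)
next
  fix ys assume ys: "ys \<in> {gs. set gs \<subseteq> K \<and> length gs = k}"
  have "surj (rotate i)" unfolding rotate_def using surj_fn[OF surj_rotate1] .
  then obtain xs where "ys = rotate i xs" by (metis surjD)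
  then show "\<exists>xs\<in>{gs. set gs \<subseteq> K \<and> length gs = k}. ys = rotate i xs" using ys by auto
qed simp

lemma partial_sum_dominated:
  assumes "finite L" "L' \<subseteq> L" "\<And>l. l \<in> L \<Longrightarrow> 0 \<le> w l"
  shows "(\<Sum>l\<in>L'. Poly_Mapping.single (f l) (complex_of_real (w l))) \<preceq>
         (\<Sum>l\<in>L. Poly_Mapping.single (f l) (complex_of_real (w l)))"
proof
  fix x
  have *: "cmod (Poly_Mapping.lookup (\<Sum>l\<in>M. Poly_Mapping.single (f l) (complex_of_real (w l))) x) =
      (\<Sum>l\<in>M. if f l = x then w l else 0)" if "M \<subseteq> L" for M
  proof -
    have "Poly_Mapping.lookup (\<Sum>l\<in>M. Poly_Mapping.single (f l) (complex_of_real (w l))) x =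
       complex_of_real (\<Sum>l\<in>M. if f l = x then w l else 0)"
      by (auto simp: lookup_sum lookup_single when_def intro!: sum.cong)
    moreover have "0 \<le> (\<Sum>l\<in>M. if f l = x then w l else 0)"
      using that assms(3) by (intro sum_nonneg) auto
    ultimately show ?thesis by (simp del: of_real_sum)
  qed
  show "cmod (Poly_Mapping.lookup (\<Sum>l\<in>L'. Poly_Mapping.single (f l) (complex_of_real (w l))) x) \<le>
        cmod (Poly_Mapping.lookup (\<Sum>l\<in>L. Poly_Mapping.single (f l) (complex_of_real (w l))) x)"
    unfolding *[OF assms(2)] *[OF subset_refl] using assms by (intro sum_mono2) auto
qed

lemma char_map_single: "char_map h (Poly_Mapping.single g c) = Poly_Mapping.single (h (conj_class g)) c"
  by (simp add: char_map_def)

lemma char_map_0 [simp]: "char_map h 0 = 0"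
  by (simp add: char_map_def)

lemma char_map_sum: "char_map h (\<Sum>i\<in>I. f i) = (\<Sum>i\<in>I. char_map h (f i))"
  by (induction I rule: infinite_finite_induct) (simp_all add: char_map_add)

lemma basis_seminorm_growth:
  fixes p :: "'g::group_add group_ring \<Rightarrow> real"
  assumes p: "unconditional_seminorm p" "\<And>a b. p (a * b) \<le> p a * p b"
    and gen: "symmetric_generating_set S"
  obtains q where "card S + 1 \<le> 2 ^ q"
    "\<And>r y. word_length S y \<le> r \<Longrightarrow> p (gr_basis y) \<le> 2 ^ (q * (r + 1))"
proof -
  have S: "finite (insert 0 S)" using gen unfolding symmetric_generating_set_def by blast
  define q where "q = card S + 1 + nat \<lceil>\<Sum>s\<in>insert 0 S. p (gr_basis s)\<rceil>"
  have q: "p (gr_basis s) \<le> 2 ^ q" if "s \<in> insert 0 S" for s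
  proof -
    have "p (gr_basis s) \<le> (\<Sum>s\<in>insert 0 S. p (gr_basis s))"
      using that S unconditional_seminormD(5)[OF p(1)] by (intro member_le_sum) auto
    also have "\<dots> \<le> real q" unfolding q_def by linarith
    also have "\<dots> \<le> 2 ^ q" using of_nat_less_two_power[of q] by (simp add: less_imp_le)
    finally show ?thesis .
  qed
  have "card S + 1 \<le> q" by (simp add: q_def)
  also have "q \<le> 2 ^ q" by (simp add: less_imp_le)
  finally have "card S + 1 \<le> 2 ^ q" .
  moreover have "p (gr_basis y) \<le> 2 ^ (q * (r + 1))" if "word_length S y \<le> r" for y r
  proof -
    have "y \<in> sum_list ` {w. set w \<subseteq> insert 0 S \<and> length w = r}"
      using ball_subset_words[OF gen, of r] that by blast
    then obtain w where w: "set w \<subseteq> insert 0 S" "length w = r" "sum_list w = y" by blast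
    have "prod_list (map gr_basis v) = gr_basis (sum_list v)" for v :: "'g list"
      by (induction v) (simp_all add: mult_single)
    moreover have "map gr_abs (map gr_basis v) = map gr_basis v" for v :: "'g list"
      by (induction v) simp_all
    ultimately have "prod_list (map gr_abs (map gr_basis (0 # w))) = gr_basis y"
      by (simp only: sum_list.Cons add_0_left w(3))
    moreover have "p (prod_list (map gr_abs (map gr_basis (0 # w)))) \<le> (2 ^ q) ^ length (map gr_basis (0 # w))"
      using q q[of 0] w(1) by (intro submultiplicative_prod_list p) auto
    ultimately show ?thesis using w(2) by (simp add: power_mult power_add)
  qed
  ultimately show thesis by (rule that)
qed

lemma power_of_two_between: "1 \<le> k \<Longrightarrow> \<exists>e. k \<le> 2 ^ e \<and> 2 ^ e \<le> 2 * k" for k :: nat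
proof (induction k rule: nat_induct_at_least)
  case base
  show ?case by (intro exI[of _ 0]) simp
next
  case (Suc k)
  then obtain e where e: "k \<le> 2 ^ e" "2 ^ e \<le> 2 * k" by blast
  show ?case
  proof (cases "Suc k \<le> 2 ^ e")
    case True
    with e show ?thesis by (intro exI[of _ e]) simp
  next
    case False
    with e(1) Suc.hyps show ?thesis by (intro exI[of _ "Suc e"]) simp
  qed
qed

lemma polynomial_times_geometric_bounded:
  fixes \<rho> :: real
  assumes "0 \<le> \<rho>" "\<rho> < 1"
  shows "\<exists>B>0. \<forall>k. real k ^ P * \<rho> ^ k \<le> B"
proof -
  have 1: "\<exists>B>0. \<forall>k. real k * \<sigma> ^ k \<le> B" if "0 \<le> \<sigma>" "\<sigma> < 1" for \<sigma> :: real
  proof -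
    have "(\<lambda>k. real k * \<sigma> ^ k) \<longlonglongrightarrow> 0" using powser_times_n_limit_0[of \<sigma>] that by simp
    then have "Bseq (\<lambda>k. real k * \<sigma> ^ k)" using convergentI convergent_imp_Bseq by blast
    then obtain B where B: "0 < B" "\<And>k. norm (real k * \<sigma> ^ k) \<le> B" by (rule BseqE) blast
    have "real k * \<sigma> ^ k \<le> B" for k
      using B(2)[of k] abs_ge_self[of "real k * \<sigma> ^ k"] unfolding real_norm_def by (rule order_trans[rotated])
    with B(1) show ?thesis by blast
  qed
  show ?thesis
  proof (cases "P = 0")
    case True
    then show ?thesis using assms by (intro exI[of _ 1]) (simp add: power_le_one)
  next
    case False
    \<comment> \<open>With \<open>\<sigma>^P = \<rho>\<close> the sequence is the \<open>P\<close>-th power of \<open>k * \<sigma>^k\<close>.\<close>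
    define \<sigma> where "\<sigma> = root P \<rho>"
    have \<sigma>: "0 \<le> \<sigma>" "\<sigma> < 1" "\<sigma> ^ P = \<rho>" using assms False by (simp_all add: \<sigma>_def)
    obtain B where B: "B > 0" "\<And>k. real k * \<sigma> ^ k \<le> B" using 1[OF \<sigma>(1,2)] by blast
    have "real k ^ P * \<rho> ^ k \<le> B ^ P" for k
    proof -
      have "real k ^ P * \<rho> ^ k = (real k * \<sigma> ^ k) ^ P"
        unfolding \<sigma>(3)[symmetric] by (simp add: power_mult_distrib mult.commute flip: power_mult)
      also have "\<dots> \<le> B ^ P" using B \<sigma> by (intro power_mono) auto
      finally show ?thesis .
    qed
    then show ?thesis using B(1) by (intro exI[of _ "B ^ P"]) simp
  qed
qed

text \<open>
  In the expansion of the product over all words \<open>gs\<close> of length \<open>k\<close>, choose for each word a cyclic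
  permutation \<open>i\<close> and a conjugator \<open>y\<close> of length \<open>O(log k)\<close>, and collect the words with equal choice \<open>(i, y)\<close>.
  Each partial sum is conjugated by \<open>u_y\<close>; before conjugation it is a part of the expansion of the cyclically
  permuted product with nonnegative coefficients, so its seminorm is at most \<open>\<rho>^k\<close>. All other factors
  are bounded by powers of \<open>2\<close> with exponent linear in \<open>e\<close>, where \<open>2^e\<close> is comparable to \<open>k\<close>.
\<close>

lemma char_map_product_bound:
  fixes p :: "'g::group_add group_ring \<Rightarrow> real"
  assumes hyp: "word_hyperbolic TYPE('g)" and gen: "symmetric_generating_set S"
    and h: "\<forall>x. h (conj_class x) \<in> conj_class x \<and>
              (\<forall>y\<in>conj_class x. word_length S (h (conj_class x)) \<le> word_length S y)"
    and p: "unconditional_seminorm p" "\<And>a b. p (a * b) \<le> p a * p b"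
    and \<rho>: "0 \<le> \<rho>" "\<rho> < 1"
    and T: "\<And>t. t \<in> T \<Longrightarrow> p t \<le> \<rho>" "\<And>t g. t \<in> T \<Longrightarrow> g \<in> Poly_Mapping.keys t \<Longrightarrow> word_length S g \<le> n"
  shows "\<exists>B>0. \<forall>ts. ts \<noteq> [] \<and> set ts \<subseteq> T \<longrightarrow> p (char_map h (prod_list (map gr_abs ts))) \<le> B"
proof -
  obtain C where C: "\<And>e gs. length gs \<le> 2 ^ e \<Longrightarrow> gs \<noteq> [] \<Longrightarrow> (\<And>g. g \<in> set gs \<Longrightarrow> word_length S g \<le> n) \<Longrightarrow>
     \<exists>i<length gs. \<exists>y. word_length S y \<le> C * (e + 1) \<and>
        h (conj_class (sum_list gs)) = - y + sum_list (rotate i gs) + y"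
    using logarithmic_conjugator[OF hyp gen h, of n] by blast
  obtain q where q: "card S + 1 \<le> 2 ^ q"
    "\<And>r y. word_length S y \<le> r \<Longrightarrow> p (gr_basis y) \<le> 2 ^ (q * (r + 1))"
    using basis_seminorm_growth[OF p gen] by blast
  note p_nonneg = unconditional_seminormD(5)[OF p(1)]
  define K where "K = {g. word_length S g \<le> n}"
  have K: "finite K" unfolding K_def by (rule ball_growth(1)[OF gen])
  \<comment> \<open>The number of pairs \<open>(i, y)\<close> and the seminorms of the two outer factors contribute \<open>k * 2^(3 * q * (r + 1))\<close>
    with \<open>r = C * (e + 1)\<close>; by \<open>2^e \<le> 2 * k\<close> this is at most a constant times \<open>k^(P + 1)\<close>.\<close>
  define P where "P = 3 * q * C"
  obtain B0 where B0: "B0 > 0" "\<And>k. real k ^ (P + 1) * \<rho> ^ k \<le> B0"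
    using polynomial_times_geometric_bounded[OF \<rho>] by blast
  define B where "B = 2 ^ (3 * q * (C + 1) + P) * B0"
  have bound: "p (char_map h (prod_list (map gr_abs ts))) \<le> B" if ts: "ts \<noteq> []" "set ts \<subseteq> T" for ts
  proof -
    define k where "k = length ts"
    have k: "1 \<le> k" using ts(1) by (cases ts) (simp_all add: k_def)
    obtain e where e: "k \<le> 2 ^ e" "2 ^ e \<le> 2 * k" using power_of_two_between[OF k] by blast
    define r where "r = C * (e + 1)"
    define L where "L = {gs. set gs \<subseteq> K \<and> length gs = k}"
    have L: "finite L" using K by (simp add: L_def finite_lists_length_eq)
    have keys: "Poly_Mapping.keys t \<subseteq> K" if "t \<in> set ts" for t
      using T(2) ts(2) that unfolding K_def by blast
    have "\<exists>ij. fst ij < k \<and> word_length S (snd ij) \<le> r \<and>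
        h (conj_class (sum_list gs)) = - snd ij + sum_list (rotate (fst ij) gs) + snd ij" if "gs \<in> L" for gs
      using C[of gs e] that e(1) k unfolding L_def K_def r_def by fastforce
    then obtain sel where sel: "\<And>gs. gs \<in> L \<Longrightarrow> fst (sel gs) < k \<and> word_length S (snd (sel gs)) \<le> r \<and>
        h (conj_class (sum_list gs)) = - snd (sel gs) + sum_list (rotate (fst (sel gs)) gs) + snd (sel gs)"
      by metis
    define J where "J = {..<k} \<times> {y. word_length S y \<le> r}"
    have J: "finite J" using ball_growth(1)[OF gen] by (simp add: J_def)
    \<comment> \<open>The part of the cyclically permuted product that belongs to the words with choice \<open>j = (i, y)\<close>.\<close>
    define part where "part j = (\<Sum>gs\<in>{gs\<in>L. sel gs = j}.
        Poly_Mapping.single (sum_list (rotate (fst j) gs)) (complex_of_real (weight ts gs)))" for j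
    have "char_map h (prod_list (map gr_abs ts)) =
        (\<Sum>gs\<in>L. Poly_Mapping.single (h (conj_class (sum_list gs))) (complex_of_real (weight ts gs)))"
      using prod_list_expansion[OF K keys] by (simp add: L_def k_def char_map_sum char_map_single)
    also have "\<dots> = (\<Sum>gs\<in>L. gr_basis (- snd (sel gs)) *
        Poly_Mapping.single (sum_list (rotate (fst (sel gs)) gs)) (complex_of_real (weight ts gs)) * gr_basis (snd (sel gs)))"
      using sel by (intro sum.cong) (simp_all add: mult_single)
    also have "\<dots> = (\<Sum>j\<in>J. \<Sum>gs\<in>{gs\<in>L. sel gs = j}. gr_basis (- snd (sel gs)) *
        Poly_Mapping.single (sum_list (rotate (fst (sel gs)) gs)) (complex_of_real (weight ts gs)) * gr_basis (snd (sel gs)))"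
      using sel by (intro sum.group[symmetric] L J) (simp add: J_def image_subset_iff mem_Times_iff)
    also have "\<dots> = (\<Sum>j\<in>J. gr_basis (- snd j) * part j * gr_basis (snd j))"
      by (intro sum.cong) (simp_all add: part_def sum_distrib_left sum_distrib_right)
    finally have "p (char_map h (prod_list (map gr_abs ts))) \<le> (\<Sum>j\<in>J. p (gr_basis (- snd j) * part j * gr_basis (snd j)))"
      using unconditional_seminorm_sum[OF p(1)] by simp
    also have "\<dots> \<le> (\<Sum>j\<in>J. 2 ^ (q * (r + 1)) * \<rho> ^ k * 2 ^ (q * (r + 1)))"
    proof (rule sum_mono)
      fix j assume j: "j \<in> J"
      obtain i y where iy: "j = (i, y)" by fastforce
      have y: "word_length S y \<le> r" using j by (simp add: J_def iy)
      have "p (part j) \<le> p (prod_list (map gr_abs (rotate i ts)))"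
      proof (rule unconditional_seminormD(3)[OF p(1)])
        have "prod_list (map gr_abs (rotate i ts)) =
            (\<Sum>gs\<in>L. Poly_Mapping.single (sum_list gs) (complex_of_real (weight (rotate i ts) gs)))"
          using prod_list_expansion[of K "rotate i ts"] K keys by (simp add: L_def k_def)
        also have "\<dots> = (\<Sum>gs\<in>L. Poly_Mapping.single (sum_list (rotate i gs)) (complex_of_real (weight (rotate i ts) (rotate i gs))))"
          unfolding L_def by (rule sum.reindex_bij_betw[OF bij_betw_rotate[OF K], symmetric])
        also have "\<dots> = (\<Sum>gs\<in>L. Poly_Mapping.single (sum_list (rotate i gs)) (complex_of_real (weight ts gs)))"
          by (intro sum.cong) (simp_all add: weight_rotate L_def k_def)
        finally show "part j \<preceq> prod_list (map gr_abs (rotate i ts))"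
          using partial_sum_dominated[OF L, of "{gs\<in>L. sel gs = j}" "weight ts" "\<lambda>gs. sum_list (rotate i gs)"]
          by (simp add: part_def iy weight_nonneg)
      qed
      also have "\<dots> \<le> \<rho> ^ k"
        using submultiplicative_prod_list[OF p, of "rotate i ts" \<rho>] ts T(1) by (auto simp: k_def)
      finally have part: "p (part j) \<le> \<rho> ^ k" .
      have "p (gr_basis (- snd j) * part j * gr_basis (snd j)) \<le> p (gr_basis (- snd j) * part j) * p (gr_basis (snd j))"
        by (rule p(2))
      also have "\<dots> \<le> (p (gr_basis (- snd j)) * p (part j)) * p (gr_basis (snd j))"
        by (intro mult_right_mono p(2) p_nonneg)
      also have "\<dots> \<le> 2 ^ (q * (r + 1)) * \<rho> ^ k * 2 ^ (q * (r + 1))"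
        using q(2)[OF y] q(2)[of "- y" r] y part gen \<rho>(1) p_nonneg
        by (intro mult_mono) (auto simp: iy intro!: mult_nonneg_nonneg)
      finally show "p (gr_basis (- snd j) * part j * gr_basis (snd j)) \<le> 2 ^ (q * (r + 1)) * \<rho> ^ k * 2 ^ (q * (r + 1))" .
    qed
    also have "\<dots> = real (card J) * (2 ^ (q * (r + 1)) * \<rho> ^ k * 2 ^ (q * (r + 1)))" by simp
    also have "\<dots> \<le> real (k * 2 ^ (q * (r + 1))) * (2 ^ (q * (r + 1)) * \<rho> ^ k * 2 ^ (q * (r + 1)))"
    proof (intro mult_right_mono)
      have "card {y. word_length S y \<le> r} \<le> (card S + 1) ^ r" by (rule ball_growth(2)[OF gen])
      also have "\<dots> \<le> (2 ^ q) ^ r" using q(1) by (intro power_mono) auto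
      also have "\<dots> \<le> 2 ^ (q * (r + 1))" unfolding power_mult[symmetric] by (intro power_increasing) auto
      finally have "card J \<le> k * 2 ^ (q * (r + 1))" by (simp add: J_def card_cartesian_product)
      then show "real (card J) \<le> real (k * 2 ^ (q * (r + 1)))" by (simp only: of_nat_le_iff)
    qed (use \<rho> in auto)
    also have "\<dots> = real k * \<rho> ^ k * (2 ^ (q * (r + 1))) ^ 3"
      by (simp add: power3_eq_cube mult_ac)
    also have "(2 ^ (q * (r + 1))) ^ 3 = (2 :: real) ^ (3 * q * (C + 1) + P * e)"
      by (simp add: r_def P_def algebra_simps flip: power_mult)
    also have "\<dots> = 2 ^ (3 * q * (C + 1)) * real (2 ^ e) ^ P"
      by (simp add: power_add mult.commute flip: power_mult)
    also have "real k * \<rho> ^ k * \<dots> \<le> real k * \<rho> ^ k * (2 ^ (3 * q * (C + 1)) * real (2 * k) ^ P)"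
      using e(2) \<rho> by (intro mult_left_mono power_mono) (simp_all only: of_nat_le_iff of_nat_0_le_iff zero_le_power mult_nonneg_nonneg zero_le_numeral)
    also have "\<dots> = 2 ^ (3 * q * (C + 1) + P) * (real k ^ (P + 1) * \<rho> ^ k)"
      by (simp add: power_add power_mult_distrib mult_ac)
    also have "\<dots> \<le> B" unfolding B_def by (intro mult_left_mono B0(2)) simp
    finally show ?thesis .
  qed
  moreover have "B > 0" using B0(1) by (simp add: B_def)
  ultimately show ?thesis by blast
qed

text \<open>
  The seminorm \<open>a \<mapsto> p m (char_map h |a|)\<close>, divided by the bound for products, belongs to the family of
  which \<open>p n\<close> is the supremum. The gap \<open>n < m\<close> provides \<open>\<rho> < 1\<close>.
\<close>

lemma char_map_bounded:
  fixes sc :: "complex \<Rightarrow> 'a::{ring_1,t2_space} \<Rightarrow> 'a" and \<iota> :: "'g::group_add group_ring \<Rightarrow> 'a"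
  assumes hyp: "word_hyperbolic TYPE('g)" and alg: "unconditional_frechet_algebra sc \<iota>"
    and gen: "symmetric_generating_set S" and U: "open U" "0 \<in> U"
    and h: "\<forall>x. h (conj_class x) \<in> conj_class x \<and>
              (\<forall>y\<in>conj_class x. word_length S (h (conj_class x)) \<le> word_length S y)"
    and nm: "1 \<le> n" "n < m"
  shows "\<exists>C\<ge>0. \<forall>a. A_seminorm sc \<iota> S U m (char_map h a) \<le> C * A_seminorm sc \<iota> S U n a"
proof -
  define T where "T = T_set sc \<iota> S U"
  define p where "p k = A_seminorm sc \<iota> S U k" for k
  have T: "spanning_products (T k)" if "1 \<le> k" for k
    unfolding T_def by (rule T_set_spanning[OF alg gen U that])
  have p: "p k = largest_seminorm (T k)" if "1 \<le> k" for k
    unfolding T_def p_def by (rule A_seminorm_eq[OF alg gen U that])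
  have pm: "p m \<in> submultiplicative_class (T m)" using p[of m] T[of m] nm largest_seminorm_in_class[of "T m"] by simp
  then have pm1: "unconditional_seminorm (p m)" and pm2: "p m (a * b) \<le> p m a * p m b"
    and pm3: "t \<in> T m \<Longrightarrow> p m t \<le> 1" for a b t
    by (auto simp: submultiplicative_class_def)
  define \<rho> where "\<rho> = (real n / real (n + 1)) / (real m / real (m + 1))"
  have "0 < real m / real (m + 1)" "real n / real (n + 1) < real m / real (m + 1)"
    using nm by (simp_all add: field_simps)
  then have \<rho>: "0 \<le> \<rho>" "\<rho> < 1" unfolding \<rho>_def by (simp_all only: divide_less_eq_1_pos) simp
  have small: "p m t \<le> \<rho>" if "t \<in> T n" for t
    unfolding \<rho>_def using T_set_shrink[OF alg nm(1) less_imp_le[OF nm(2)] that[unfolded T_def] pm1 pm3[unfolded T_def]] .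
  have keys: "word_length S g \<le> n" if "t \<in> T n" "g \<in> Poly_Mapping.keys t" for t g
    using that by (auto simp: T_def T_set_def)
  have "\<exists>B>0. \<forall>ts. ts \<noteq> [] \<and> set ts \<subseteq> T n \<longrightarrow> p m (char_map h (prod_list (map gr_abs ts))) \<le> B"
    by (rule char_map_product_bound[OF hyp gen h pm1 pm2 \<rho> small keys])
  then obtain B where B0: "0 < B \<and> (\<forall>ts. ts \<noteq> [] \<and> set ts \<subseteq> T n \<longrightarrow> p m (char_map h (prod_list (map gr_abs ts))) \<le> B)"
    by (rule exE)
  then have Bpos: "0 < B"
    and B: "\<And>ts. ts \<noteq> [] \<Longrightarrow> set ts \<subseteq> T n \<Longrightarrow> p m (char_map h (prod_list (map gr_abs ts))) \<le> B"
    by simp_all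
  define F where "F a = 1 / B * p m (char_map h (gr_abs a))" for a
  have "unconditional_seminorm F" unfolding F_def using Bpos
    by (intro unconditional_seminorm_times positive_map_seminorm[OF positive_map_char_map pm1]) simp
  moreover have "F (prod_list (map gr_abs ts)) \<le> 1" if "ts \<noteq> []" "set ts \<subseteq> T n" for ts
    using Bpos B[OF that] gr_abs_prod_list_fixed[OF that(1)] by (simp add: F_def)
  ultimately have F: "F \<in> product_bounded (T n)" by (simp add: product_bounded_def)
  have "p m (char_map h a) \<le> B * p n a" for a
  proof -
    have "char_map h a \<preceq> char_map h (gr_abs a)"
      using positive_map_char_map[of h] unfolding positive_map_def by blast
    then have "p m (char_map h a) \<le> p m (char_map h (gr_abs a))"
      by (rule unconditional_seminormD(3)[OF pm1])
    also have "\<dots> = B * F a" using Bpos by (simp add: F_def)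
    also have "\<dots> \<le> B * p n a"
      using le_largest_seminorm[OF T[OF nm(1)] F, of a] Bpos p[OF nm(1)] by simp
    finally show ?thesis .
  qed
  then show ?thesis unfolding p_def using Bpos by (intro exI[of _ B]) auto
qed

section \<open>Operators on completions and on their union\<close>

definition sequence_subspace :: "(nat \<Rightarrow> 'g group_ring) set \<Rightarrow> bool" where
  "sequence_subspace N \<longleftrightarrow> 0 \<in> N \<and> (\<forall>X\<in>N. \<forall>Y\<in>N. X + Y \<in> N \<and> X - Y \<in> N) \<and>
     (\<forall>c. \<forall>X\<in>N. (\<lambda>i. gr_scale c (X i)) \<in> N)"

lemma sequence_subspaceD:
  assumes "sequence_subspace N"
  shows "0 \<in> N" "X \<in> N \<Longrightarrow> Y \<in> N \<Longrightarrow> X + Y \<in> N" "X \<in> N \<Longrightarrow> Y \<in> N \<Longrightarrow> X - Y \<in> N"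
    "X \<in> N \<Longrightarrow> (\<lambda>i. gr_scale c (X i)) \<in> N"
  using assms unfolding sequence_subspace_def by blast+

lemma subspace_plus:
  assumes "sequence_subspace M" "N \<subseteq> M" "0 \<in> N"
  shows "N + M = M"
proof
  show "N + M \<subseteq> M" using assms sequence_subspaceD(2)[OF assms(1)] by (auto simp: set_plus_def)
  show "M \<subseteq> N + M" using assms(3) by (rule set_zero_plus2)
qed

lemma coset_plus_coset:
  assumes "sequence_subspace N"
  shows "(X +o N) + (Y +o N) = (X + Y) +o N"
  using subspace_plus[OF assms subset_refl sequence_subspaceD(1)[OF assms]] by (simp add: set_plus_rearrange)

lemma coset_plus_larger:
  assumes "sequence_subspace M" "N \<subseteq> M" "0 \<in> N"
  shows "(X +o N) + M = X +o M"
  using subspace_plus[OF assms] by (simp add: set_plus_rearrange3)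

text \<open>
  The image of a coset under \<open>f\<close> need not be a full coset; adding \<open>N\<close> makes it one. Scalar multiplication
  of cosets is the special case \<open>f = gr_scale c\<close>.
\<close>

definition induced_map ::
  "('g group_ring \<Rightarrow> 'g group_ring) \<Rightarrow> (nat \<Rightarrow> 'g group_ring) set \<Rightarrow> (nat \<Rightarrow> 'g group_ring) set \<Rightarrow> (nat \<Rightarrow> 'g group_ring) set"
  where "induced_map f N \<xi> = (\<lambda>X i. f (X i)) ` \<xi> + N"

lemma induced_map_coset:
  assumes f: "\<And>a b. f (a + b) = f a + f b" and N': "sequence_subspace N'"
    and N: "0 \<in> N" "\<And>X. X \<in> N \<Longrightarrow> (\<lambda>i. f (X i)) \<in> N'"
  shows "induced_map f N' (X +o N) = (\<lambda>i. f (X i)) +o N'"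
proof -
  have coset_image: "Z +o M = (\<lambda>Y. Z + Y) ` M" for Z :: "nat \<Rightarrow> 'a group_ring" and M
    by (auto simp: elt_set_plus_def)
  have "(\<lambda>X i. f (X i)) ` (X +o N) = (\<lambda>i. f (X i)) +o ((\<lambda>X i. f (X i)) ` N)"
    unfolding coset_image by (simp add: image_image f plus_fun_def)
  moreover have "(\<lambda>X i. f (X i)) ` N + N' = N'"
  proof
    show "(\<lambda>X i. f (X i)) ` N + N' \<subseteq> N'"
      using N(2) sequence_subspaceD(2)[OF N'] by (auto simp: set_plus_def)
    show "N' \<subseteq> (\<lambda>X i. f (X i)) ` N + N'"
    proof
      fix Y assume Y: "Y \<in> N'"
      let ?Z = "\<lambda>i. f ((0 :: nat \<Rightarrow> 'a group_ring) i)"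
      have "?Z \<in> N'" using N by blast
      then have "Y - ?Z \<in> N'" using sequence_subspaceD(3)[OF N' Y] by blast
      moreover have "?Z \<in> (\<lambda>X i. f (X i)) ` N" using N(1) by blast
      ultimately have "?Z + (Y - ?Z) \<in> (\<lambda>X i. f (X i)) ` N + N'" by (intro set_plus_intro)
      then show "Y \<in> (\<lambda>X i. f (X i)) ` N + N'" by simp
    qed
  qed
  ultimately show ?thesis by (simp add: induced_map_def set_plus_rearrange3)
qed

lemma coset_scale_eq_induced_map: "coset_scale N c = induced_map (gr_scale c) N"
  by (rule ext) (simp add: coset_scale_def induced_map_def)

lemma gr_scale_add: "gr_scale c (a + b) = gr_scale c a + gr_scale c b"
  by (rule poly_mapping_eqI) (simp add: lookup_add distrib_left)

lemma coset_scale_coset: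
  assumes "sequence_subspace N"
  shows "coset_scale N c (X +o N) = (\<lambda>i. gr_scale c (X i)) +o N"
  unfolding coset_scale_eq_induced_map
  by (rule induced_map_coset) (use assms in \<open>auto simp: gr_scale_add sequence_subspaceD\<close>)

lemma linear_map_on_induced_map:
  assumes f: "\<And>a b. f (a + b) = f a + f b" "\<And>c a. f (gr_scale c a) = gr_scale c (f a)"
    and N: "sequence_subspace N" and N': "sequence_subspace N'"
    and fN: "\<And>X. X \<in> N \<Longrightarrow> (\<lambda>i. f (X i)) \<in> N'" and fV: "\<And>X. X \<in> V \<Longrightarrow> (\<lambda>i. f (X i)) \<in> V'"
  shows "linear_map_on ((\<lambda>X. X +o N) ` V) (coset_scale N) ((\<lambda>X. X +o N') ` V') (coset_scale N') (induced_map f N')"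
proof -
  have I: "induced_map f N' (X +o N) = (\<lambda>i. f (X i)) +o N'" for X
    using induced_map_coset[of f N' N X] f(1) N' fN sequence_subspaceD(1)[OF N] by blast
  show ?thesis unfolding linear_map_on_def
  proof (intro conjI ballI allI)
    show "induced_map f N' ` (\<lambda>X. X +o N) ` V \<subseteq> (\<lambda>X. X +o N') ` V'" using fV by (auto simp: I)
  next
    fix x y assume "x \<in> (\<lambda>X. X +o N) ` V" "y \<in> (\<lambda>X. X +o N) ` V"
    then obtain X Y where "x = X +o N" "y = Y +o N" by blast
    then show "induced_map f N' (x + y) = induced_map f N' x + induced_map f N' y"
      by (simp add: coset_plus_coset[OF N] coset_plus_coset[OF N'] I f(1) plus_fun_def)
  next
    fix c x assume "x \<in> (\<lambda>X. X +o N) ` V"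
    then obtain X where "x = X +o N" by blast
    then show "induced_map f N' (coset_scale N c x) = coset_scale N' c (induced_map f N' x)"
      by (simp add: coset_scale_coset[OF N] coset_scale_coset[OF N'] I f(2))
  qed
qed

lemma seminorm_diff_triangle:
  assumes "unconditional_seminorm p"
  shows "\<bar>p a - p b\<bar> \<le> p (a - b)"
proof -
  note p = unconditional_seminormD[OF assms]
  have "p (b - a) \<le> p (a - b)" by (rule p(3)) (simp add: lookup_minus norm_minus_commute)
  then show ?thesis using p(1)[of "a - b" b] p(1)[of "b - a" a] by simp
qed

lemma null_seqs_subspace:
  assumes "unconditional_seminorm p"
  shows "sequence_subspace (null_seqs p)"
proof -
  note p = unconditional_seminormD[OF assms]
  have squeeze: "(\<lambda>i. p (Z i)) \<longlonglongrightarrow> 0"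
    if "(\<lambda>i. p (X i)) \<longlonglongrightarrow> 0" "(\<lambda>i. p (Y i)) \<longlonglongrightarrow> 0" "\<And>i. p (Z i) \<le> p (X i) + p (Y i)" for X Y Z
    using tendsto_add[OF that(1,2)] that(3) p(5)
    by (intro tendsto_sandwich[of "\<lambda>_. 0" "\<lambda>i. p (Z i)" _ "\<lambda>i. p (X i) + p (Y i)"]) auto
  show ?thesis unfolding sequence_subspace_def null_seqs_def
    using squeeze[OF _ _ p(1)] squeeze[OF _ _ p(7)]
    by (auto simp: p(2,4) intro: tendsto_mult_right_zero)
qed

text \<open>
  The seminorms of a Cauchy sequence converge, and a null sequence does not change their limit, so the
  limit in the definition of \<open>completion_norm\<close> exists and is the same for all representatives.
\<close>

lemma completion_norm_lim:
  assumes p: "unconditional_seminorm p" and X: "X \<in> cauchy_seqs p"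
  shows "(\<lambda>i. p (X i)) \<longlonglongrightarrow> completion_norm p (X +o null_seqs p)"
proof -
  have "Cauchy (\<lambda>i. p (X i))"
  proof (rule metric_CauchyI)
    fix e :: real assume "0 < e"
    then obtain M where M: "\<And>i j. i \<ge> M \<Longrightarrow> j \<ge> M \<Longrightarrow> p (X i - X j) < e"
      using X unfolding cauchy_seqs_def by blast
    have "dist (p (X i)) (p (X j)) < e" if "i \<ge> M" "j \<ge> M" for i j
      using M[OF that] seminorm_diff_triangle[OF p, of "X i" "X j"] by (simp add: dist_real_def)
    then show "\<exists>M. \<forall>m\<ge>M. \<forall>n\<ge>M. dist (p (X m)) (p (X n)) < e" by blast
  qed
  then obtain r where r: "(\<lambda>i. p (X i)) \<longlonglongrightarrow> r"
    using Cauchy_convergent convergent_def by blast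
  have all: "(\<lambda>i. p (Z i)) \<longlonglongrightarrow> r" if "Z \<in> X +o null_seqs p" for Z
  proof -
    from that have lim: "(\<lambda>i. p ((Z - X) i)) \<longlonglongrightarrow> 0"
      by (auto simp: elt_set_plus_def null_seqs_def)
    have "\<forall>i. norm (p (Z i) - p (X i)) \<le> p ((Z - X) i)"
      using seminorm_diff_triangle[OF p] by simp
    from Lim_null_comparison[OF always_eventually[OF this] lim]
    have "(\<lambda>i. p (Z i) - p (X i)) \<longlonglongrightarrow> 0" .
    from tendsto_add[OF this r] show ?thesis by simp
  qed
  have "X \<in> X +o null_seqs p"
    using sequence_subspaceD(1)[OF null_seqs_subspace[OF p]] by (auto simp: elt_set_plus_def)
  then have "completion_norm p (X +o null_seqs p) = r"
    unfolding completion_norm_def using all LIMSEQ_unique[OF r] by (intro the_equality) blast+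
  then show ?thesis using r by simp
qed

lemma induced_map_completion:
  assumes p: "unconditional_seminorm p" and q: "unconditional_seminorm q"
    and f: "\<And>a b. f (a + b) = f a + f b" "\<And>c a. f (gr_scale c a) = gr_scale c (f a)"
    and C: "0 \<le> C" "\<And>a. q (f a) \<le> C * p a"
  shows "\<And>X. X \<in> null_seqs p \<Longrightarrow> (\<lambda>i. f (X i)) \<in> null_seqs q"
    "\<And>X. X \<in> cauchy_seqs p \<Longrightarrow> (\<lambda>i. f (X i)) \<in> cauchy_seqs q"
    "\<And>X. induced_map f (null_seqs q) (X +o null_seqs p) = (\<lambda>i. f (X i)) +o null_seqs q"
    "\<And>\<xi>. \<xi> \<in> cauchy_completion p \<Longrightarrow>
       completion_norm q (induced_map f (null_seqs q) \<xi>) \<le> C * completion_norm p \<xi>"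
proof -
  note qD = unconditional_seminormD[OF q]
  show null: "(\<lambda>i. f (X i)) \<in> null_seqs q" if "X \<in> null_seqs p" for X
    using that C(2) qD(5) tendsto_mult_right_zero[of "\<lambda>i. p (X i)" sequentially C] unfolding null_seqs_def
    by (auto intro!: tendsto_sandwich[of "\<lambda>_. 0" "\<lambda>i. q (f (X i))" _ "\<lambda>i. C * p (X i)"])
  have fdiff: "f a - f b = f (a - b)" for a b using f(1)[of "a - b" b] by (simp add: algebra_simps)
  show cauchy: "(\<lambda>i. f (X i)) \<in> cauchy_seqs q" if X: "X \<in> cauchy_seqs p" for X
    unfolding cauchy_seqs_def
  proof (intro CollectI allI impI)
    fix e :: real assume "0 < e"
    then have "0 < e / (C + 1)" using C(1) by simp
    then obtain M where M: "\<And>i j. i \<ge> M \<Longrightarrow> j \<ge> M \<Longrightarrow> p (X i - X j) < e / (C + 1)"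
      using X unfolding cauchy_seqs_def by blast
    have "q (f (X i) - f (X j)) < e" if "i \<ge> M" "j \<ge> M" for i j
    proof -
      have "q (f (X i) - f (X j)) \<le> C * p (X i - X j)" unfolding fdiff by (rule C(2))
      also have "\<dots> \<le> (C + 1) * p (X i - X j)"
        using unconditional_seminormD(5)[OF p] by (intro mult_right_mono) auto
      also have "\<dots> < (C + 1) * (e / (C + 1))" using M[OF that] C(1) by (intro mult_strict_left_mono) auto
      finally show ?thesis using C(1) by simp
    qed
    then show "\<exists>M. \<forall>i\<ge>M. \<forall>j\<ge>M. q (f (X i) - f (X j)) < e" by blast
  qed
  show I: "induced_map f (null_seqs q) (X +o null_seqs p) = (\<lambda>i. f (X i)) +o null_seqs q" for X
    using induced_map_coset[of f "null_seqs q" "null_seqs p" X] f(1) null null_seqs_subspace[OF q]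
      sequence_subspaceD(1)[OF null_seqs_subspace[OF p]] by blast
  show "completion_norm q (induced_map f (null_seqs q) \<xi>) \<le> C * completion_norm p \<xi>"
    if \<xi>: "\<xi> \<in> cauchy_completion p" for \<xi>
  proof -
    obtain X where X: "X \<in> cauchy_seqs p" "\<xi> = X +o null_seqs p"
      using \<xi> unfolding cauchy_completion_def by blast
    have "(\<lambda>i. q (f (X i))) \<longlonglongrightarrow> completion_norm q (induced_map f (null_seqs q) \<xi>)"
      using completion_norm_lim[OF q cauchy[OF X(1)]] by (simp add: X(2) I)
    moreover have "(\<lambda>i. C * p (X i)) \<longlonglongrightarrow> C * completion_norm p \<xi>"
      unfolding X(2) by (intro tendsto_mult_left completion_norm_lim[OF p X(1)])
    ultimately show ?thesis by (rule LIMSEQ_le) (use C(2) in blast)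
  qed
qed

lemma bounded_operator_completion_induced_map:
  assumes "unconditional_seminorm p" "unconditional_seminorm q"
    "\<And>a b. f (a + b) = f a + f b" "\<And>c a. f (gr_scale c a) = gr_scale c (f a)"
    "0 \<le> C" "\<And>a. q (f a) \<le> C * p a"
  shows "bounded_operator_completion p q (induced_map f (null_seqs q))"
  unfolding bounded_operator_completion_def cauchy_completion_def[symmetric]
proof (intro conjI exI ballI)
  show "linear_map_on (cauchy_completion p) (coset_scale (null_seqs p))
     (cauchy_completion q) (coset_scale (null_seqs q)) (induced_map f (null_seqs q))"
    unfolding cauchy_completion_def
    using assms by (intro linear_map_on_induced_map null_seqs_subspace induced_map_completion(1,2)[of p q f C])
  show "completion_norm q (induced_map f (null_seqs q) \<xi>) \<le> C * completion_norm p \<xi>"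
    if "\<xi> \<in> cauchy_completion p" for \<xi>
    using assms that by (intro induced_map_completion(4)[of p q f C])
qed

locale decreasing_seminorms =
  fixes p :: "nat \<Rightarrow> 'g group_ring \<Rightarrow> real"
  assumes seminorm: "1 \<le> n \<Longrightarrow> unconditional_seminorm (p n)"
    and decreasing: "1 \<le> n \<Longrightarrow> n \<le> m \<Longrightarrow> p m a \<le> p n a"
begin

lemma null_seqs_mono:
  assumes "1 \<le> n" "n \<le> m"
  shows "null_seqs (p n) \<subseteq> null_seqs (p m)"
proof
  fix X assume "X \<in> null_seqs (p n)"
  then show "X \<in> null_seqs (p m)"
    using decreasing[OF assms] unconditional_seminormD(5)[OF seminorm[of m]] assms unfolding null_seqs_def
    by (auto intro!: tendsto_sandwich[of "\<lambda>_. 0" "\<lambda>i. p m (X i)" _ "\<lambda>i. p n (X i)"])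
qed

lemma null_seqs_subset_union_null: "1 \<le> n \<Longrightarrow> null_seqs (p n) \<subseteq> union_null p"
  unfolding union_null_def by auto

text \<open>
  Two sequences that are null for different seminorms are both null for the smaller one.
\<close>

lemma union_null_subspace: "sequence_subspace (union_null p)"
  unfolding sequence_subspace_def
proof (intro conjI ballI allI)
  note sub = sequence_subspaceD[OF null_seqs_subspace[OF seminorm]]
  show "0 \<in> union_null p" using sub(1)[of 1] unfolding union_null_def by auto
  fix X assume X: "X \<in> union_null p"
  then obtain n where n: "1 \<le> n" "X \<in> null_seqs (p n)" unfolding union_null_def by auto
  show "(\<lambda>i. gr_scale c (X i)) \<in> union_null p" for c
    using sub(4)[OF n] null_seqs_subset_union_null[OF n(1)] by blast
  fix Y assume Y: "Y \<in> union_null p"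
  then obtain m where m: "1 \<le> m" "Y \<in> null_seqs (p m)" unfolding union_null_def by auto
  have k: "1 \<le> max n m" using n by simp
  have "X \<in> null_seqs (p (max n m))" "Y \<in> null_seqs (p (max n m))"
    using null_seqs_mono[of n "max n m"] null_seqs_mono[of m "max n m"] n m by auto
  then have "X + Y \<in> null_seqs (p (max n m))" "X - Y \<in> null_seqs (p (max n m))"
    using sub(2,3)[OF k] by blast+
  then show "X + Y \<in> union_null p" "X - Y \<in> union_null p"
    using null_seqs_subset_union_null[OF k] by blast+
qed

lemma to_union_coset: "1 \<le> n \<Longrightarrow> to_union p (X +o null_seqs (p n)) = X +o union_null p"
  unfolding to_union_def
  using null_seqs_subset_union_null sequence_subspaceD(1)[OF null_seqs_subspace[OF seminorm]]
  by (intro coset_plus_larger union_null_subspace)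

context
  fixes f :: "'g group_ring \<Rightarrow> 'g group_ring"
  assumes f: "\<And>a b. f (a + b) = f a + f b" "\<And>c a. f (gr_scale c a) = gr_scale c (f a)"
    and bounded: "\<And>n m. 1 \<le> n \<Longrightarrow> n < m \<Longrightarrow> \<exists>C\<ge>0. \<forall>a. p m (f a) \<le> C * p n a"
begin

lemma induced_map_level:
  assumes nm: "1 \<le> n" "n < m"
  shows "bounded_operator_completion (p n) (p m) (induced_map f (null_seqs (p m)))"
    "induced_map f (null_seqs (p m)) (X +o null_seqs (p n)) = (\<lambda>i. f (X i)) +o null_seqs (p m)"
    "X \<in> null_seqs (p n) \<Longrightarrow> (\<lambda>i. f (X i)) \<in> null_seqs (p m)"
    "X \<in> cauchy_seqs (p n) \<Longrightarrow> (\<lambda>i. f (X i)) \<in> cauchy_seqs (p m)"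
proof -
  obtain C where C: "0 \<le> C" "\<And>a. p m (f a) \<le> C * p n a" using bounded[OF nm] by blast
  have m: "1 \<le> m" using nm by simp
  note * = seminorm[OF nm(1)] seminorm[OF m] f C
  show "bounded_operator_completion (p n) (p m) (induced_map f (null_seqs (p m)))"
    by (rule bounded_operator_completion_induced_map[OF *])
  show "induced_map f (null_seqs (p m)) (X +o null_seqs (p n)) = (\<lambda>i. f (X i)) +o null_seqs (p m)"
    "X \<in> null_seqs (p n) \<Longrightarrow> (\<lambda>i. f (X i)) \<in> null_seqs (p m)"
    "X \<in> cauchy_seqs (p n) \<Longrightarrow> (\<lambda>i. f (X i)) \<in> cauchy_seqs (p m)"
    by (rule induced_map_completion[OF *], assumption?)+
qed

lemma union_null_invariant: "X \<in> union_null p \<Longrightarrow> (\<lambda>i. f (X i)) \<in> union_null p"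
proof -
  assume "X \<in> union_null p"
  then obtain n where n: "1 \<le> n" "X \<in> null_seqs (p n)" unfolding union_null_def by auto
  then have "(\<lambda>i. f (X i)) \<in> null_seqs (p (n + 1))" by (intro induced_map_level(3)[of n]) auto
  then show ?thesis using null_seqs_subset_union_null[of "n + 1"] by auto
qed

lemma induced_map_union_coset: "induced_map f (union_null p) (X +o union_null p) = (\<lambda>i. f (X i)) +o union_null p"
  using f(1) union_null_subspace union_null_invariant
  by (intro induced_map_coset sequence_subspaceD(1)[OF union_null_subspace])

lemma induced_map_to_union:
  assumes "1 \<le> n" "n < m" "\<xi> \<in> cauchy_completion (p n)"
  shows "induced_map f (union_null p) (to_union p \<xi>) = to_union p (induced_map f (null_seqs (p m)) \<xi>)"
proof -
  obtain X where X: "\<xi> = X +o null_seqs (p n)" using assms(3) unfolding cauchy_completion_def by blast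
  show ?thesis unfolding X induced_map_level(2)[OF assms(1,2)]
    using assms by (simp add: to_union_coset induced_map_union_coset)
qed

text \<open>
  A bounded set lives on some level \<open>n\<close>, and its image is bounded on the level \<open>n + 1\<close>.
\<close>

lemma bounded_operator_union_induced_map: "bounded_operator_union p (induced_map f (union_null p))"
  unfolding bounded_operator_union_def
proof (intro conjI allI impI)
  have "(\<lambda>i. f (X i)) \<in> (\<Union>n\<in>{1..}. cauchy_seqs (p n))" if "X \<in> (\<Union>n\<in>{1..}. cauchy_seqs (p n))" for X
  proof -
    obtain n where n: "1 \<le> n" "X \<in> cauchy_seqs (p n)" using \<open>X \<in> _\<close> by auto
    then have "(\<lambda>i. f (X i)) \<in> cauchy_seqs (p (n + 1))" by (intro induced_map_level(4)[of n]) auto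
    then show ?thesis by (intro UN_I[of "n + 1"]) auto
  qed
  then show "linear_map_on (union_space p) (coset_scale (union_null p)) (union_space p)
      (coset_scale (union_null p)) (induced_map f (union_null p))"
    unfolding union_space_def
    by (intro linear_map_on_induced_map f union_null_subspace union_null_invariant)
next
  fix B assume "union_bounded p B"
  then obtain n B' r where B: "1 \<le> n" "B' \<subseteq> cauchy_completion (p n)"
    "\<And>\<xi>. \<xi> \<in> B' \<Longrightarrow> completion_norm (p n) \<xi> \<le> r" "B = to_union p ` B'"
    unfolding union_bounded_def by blast
  let ?\<Psi> = "induced_map f (null_seqs (p (n + 1)))"
  have n: "n < n + 1" "1 \<le> n + 1" by simp_all
  obtain C where C: "0 \<le> C" "\<And>a. p (n + 1) (f a) \<le> C * p n a" using bounded[OF B(1) n(1)] by blast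
  have "completion_norm (p (n + 1)) (?\<Psi> \<xi>) \<le> C * r" if "\<xi> \<in> B'" for \<xi>
  proof -
    have "completion_norm (p (n + 1)) (?\<Psi> \<xi>) \<le> C * completion_norm (p n) \<xi>"
      using induced_map_completion(4)[OF seminorm[OF B(1)] seminorm[OF n(2)] f C] B(2) that by blast
    also have "\<dots> \<le> C * r" by (rule mult_left_mono[OF B(3)[OF that] C(1)])
    finally show ?thesis .
  qed
  moreover have "?\<Psi> ` B' \<subseteq> cauchy_completion (p (n + 1))"
    using induced_map_level(1)[OF B(1) n(1)] B(2)
    unfolding bounded_operator_completion_def linear_map_on_def by blast
  moreover have "induced_map f (union_null p) ` B = to_union p ` ?\<Psi> ` B'"
    unfolding B(4) image_image using B(2) by (intro image_cong induced_map_to_union[OF B(1) n(1)]) auto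
  ultimately show "union_bounded p (induced_map f (union_null p) ` B)"
    unfolding union_bounded_def using n(2)
    by (intro exI[of _ "n + 1"] conjI exI[of _ "?\<Psi> ` B'"] exI[of _ "C * r"]) auto
qed

end

end

section \<open>Extension of the characteristic map\<close>

theorem theorem5p4:
  fixes sc :: "complex \<Rightarrow> 'a::{ring_1,t2_space} \<Rightarrow> 'a"
    and \<iota> :: "'g::group_add group_ring \<Rightarrow> 'a"
    and S :: "'g set" and U :: "'a set" and h :: "'g set \<Rightarrow> 'g"
  assumes hyp: "word_hyperbolic TYPE('g)"
    and alg: "unconditional_frechet_algebra sc \<iota>"
    and adm: "admissible TYPE('a)"
    and gen: "symmetric_generating_set S"
    and ball: "open_unit_ball U" and stable: "\<forall>x\<in>U. alg_abs \<iota> x \<in> U"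
    and h: "\<forall>x. h (conj_class x) \<in> conj_class x \<and>
              (\<forall>y\<in>conj_class x. word_length S (h (conj_class x)) \<le> word_length S y)"
  shows "let p = A_seminorm sc \<iota> S U in
    \<exists>\<Phi>. bounded_operator_union p \<Phi> \<and>
        (\<forall>a. \<Phi> (union_embed p a) = union_embed p (char_map h a)) \<and>
        (\<forall>n m. 1 \<le> n \<and> n < m \<longrightarrow>
           (\<exists>\<Psi>. bounded_operator_completion (p n) (p m) \<Psi> \<and>
                (\<forall>a. \<Psi> (completion_embed (p n) a) = completion_embed (p m) (char_map h a)) \<and>
                (\<forall>\<xi>\<in>cauchy_completion (p n). \<Phi> (to_union p \<xi>) = to_union p (\<Psi> \<xi>))))"
proof -
  define p where "p = A_seminorm sc \<iota> S U"
  have U: "open U" "0 \<in> U" using ball unfolding open_unit_ball_def by blast+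
  interpret decreasing_seminorms p
    unfolding p_def
    by unfold_locales (rule A_seminorm_unconditional[OF alg gen U] A_seminorm_antimono[OF alg gen U], assumption+)+
  have bounded: "\<exists>C\<ge>0. \<forall>a. p m (char_map h a) \<le> C * p n a" if "1 \<le> n" "n < m" for n m
    unfolding p_def by (rule char_map_bounded[OF hyp alg gen U h that])
  note f = char_map_add[of h] char_map_scale[of h] bounded
  let ?\<Phi> = "induced_map (char_map h) (union_null p)"
  show ?thesis
    unfolding p_def[symmetric] Let_def
  proof (rule exI[of _ ?\<Phi>], intro conjI allI impI)
    show "bounded_operator_union p ?\<Phi>" by (rule bounded_operator_union_induced_map[OF f])
    show "?\<Phi> (union_embed p a) = union_embed p (char_map h a)" for a
      unfolding union_embed_def by (rule induced_map_union_coset[OF f])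
    fix n m :: nat assume "1 \<le> n \<and> n < m"
    then have nm: "1 \<le> n" "n < m" by blast+
    let ?\<Psi> = "induced_map (char_map h) (null_seqs (p m))"
    show "\<exists>\<Psi>. bounded_operator_completion (p n) (p m) \<Psi> \<and>
        (\<forall>a. \<Psi> (completion_embed (p n) a) = completion_embed (p m) (char_map h a)) \<and>
        (\<forall>\<xi>\<in>cauchy_completion (p n). ?\<Phi> (to_union p \<xi>) = to_union p (\<Psi> \<xi>))"
    proof (rule exI[of _ ?\<Psi>], intro conjI allI ballI)
      show "bounded_operator_completion (p n) (p m) ?\<Psi>" by (rule induced_map_level(1)[OF f nm])
      show "?\<Psi> (completion_embed (p n) a) = completion_embed (p m) (char_map h a)" for a
        unfolding completion_embed_def by (rule induced_map_level(2)[OF f nm])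
      show "?\<Phi> (to_union p \<xi>) = to_union p (?\<Psi> \<xi>)" if "\<xi> \<in> cauchy_completion (p n)" for \<xi>
        by (rule induced_map_to_union[OF f nm that])
    qed
  qed
qed

end
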